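(* Let $A$ be a real $n\times n$ matrix that is diagonalizable over $\mathbb{C}$ and all of whose eigenvalues have positive real part. Then the volume entropy of the Abelian Heintze group $G(A)$ is $$\delta(G(A))=\operatorname{tr}(J),$$ where $J$ is the complex Jordan form of $A$.
   Context: $G(A)=\mathbb{R}^n\rtimes_A\mathbb{R}$ is the Lie group with underlying manifold $\mathbb{R}^n\times\mathbb{R}$ and product $(x,t)*(x',t')=(x+\exp(tA)x',\,t+t')$. It carries a left-invariant Riemannian metric determined by an inner product on its Lie algebra $\mathbb{R}^n\oplus\mathbb{R}\partial_t$ for which $\partial_t$ is a unit vector orthogonal to $\mathbb{R}^n$ and for which a basis of $\mathbb{R}^n$ putting $A$ in real Jordan block-diagonal form (blocks $(\alpha)$ and $\begin{pmatrix}\alpha&-\beta\\ \beta&\alpha\end{pmatrix}$, since $A$ is diagonalizable over $\mathbb{C}$) is orthonormal. The volume entropy of a homogeneous Riemannian manifold is $\delta=\lim_{r\to\infty}\frac{\log\operatorname{Vol}(B(x,r))}{r}$, where $B(x,r)$ is the geodesic ball of center $x$ and radius $r$ (independent of $x$ by homogeneity). *)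

theory Defs
  imports
    "HOL-Analysis.Analysis"
    "Jordan_Normal_Form.Jordan_Normal_Form"
begin

section \<open>Linear algebra\<close>

definition matrix_exp :: "real ^ 'n ^ 'n \<Rightarrow> real ^ 'n ^ 'n" where
  "matrix_exp M = (\<Sum>k. (1 / fact k) *\<^sub>R ((**) M ^^ k) (Finite_Cartesian_Product.mat 1))"

text \<open>The index type of \<open>real ^ 'n\<close> carries no order; an arbitrary fixed enumeration turns a matrix
  into one with rows and columns numbered from \<open>0\<close>. The choice only matters up to similarity
  by a permutation matrix.\<close>

definition index_enum :: "nat \<Rightarrow> 'n::finite" where
  "index_enum = (SOME e. bij_betw e {..<CARD('n)} UNIV)"

definition complex_mat_of :: "real ^ 'n ^ 'n \<Rightarrow> complex mat" where
  "complex_mat_of A = Matrix.mat CARD('n) CARD('n)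
     (\<lambda>(i, j). complex_of_real (vec_nth (vec_nth A (index_enum i)) (index_enum j)))"

definition diagonalizable_mat :: "'a::semiring_1 mat \<Rightarrow> bool" where
  "diagonalizable_mat M \<longleftrightarrow> (\<exists>D. diagonal_mat D \<and> similar_mat M D)"

definition mat_trace :: "'a::comm_monoid_add mat \<Rightarrow> 'a" where
  "mat_trace M = (\<Sum>i<dim_row M. M $$ (i, i))"

definition real_jordan_blocks :: "real mat set" where
  "real_jordan_blocks =
     {mat_of_rows_list 1 [[\<alpha>]] | \<alpha>. True} \<union>
     {mat_of_rows_list 2 [[\<alpha>, -\<beta>], [\<beta>, \<alpha>]] | \<alpha> \<beta>. True}"

text \<open>\<open>b 0, \<dots>, b (n - 1)\<close> is a basis in which the endomorphism \<open>A\<close> is represented by a block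
  diagonal matrix \<open>D\<close> with blocks as above (column \<open>j\<close> of \<open>D\<close> holds the coordinates of
  \<open>A (b j)\<close>).\<close>

definition real_jordan_basis :: "real ^ 'n ^ 'n \<Rightarrow> (nat \<Rightarrow> real ^ 'n) \<Rightarrow> bool" where
  "real_jordan_basis A b \<longleftrightarrow>
     inj_on b {..<CARD('n)} \<and> independent (b ` {..<CARD('n)}) \<and> span (b ` {..<CARD('n)}) = UNIV \<and>
     (\<exists>Bs. set Bs \<subseteq> real_jordan_blocks \<and> diag_block_mat Bs \<in> carrier_mat CARD('n) CARD('n) \<and>
        (\<forall>j<CARD('n). A *v b j = (\<Sum>i<CARD('n). diag_block_mat Bs $$ (i, j) *\<^sub>R b i)))"

definition inner_product_form :: "('a::real_vector \<Rightarrow> 'a \<Rightarrow> real) \<Rightarrow> bool" where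
  "inner_product_form B \<longleftrightarrow>
     bilinear B \<and> (\<forall>v w. B v w = B w v) \<and> (\<forall>v. v \<noteq> 0 \<longrightarrow> B v v > 0)"


section \<open>Riemannian geometry in a global chart\<close>

text \<open>A Riemannian metric on a Euclidean space is given by the family \<open>g p\<close> of inner products on
  the tangent spaces, each identified with the ambient vector space. Lengths and
  distances are extended nonnegative reals, so curves of infinite length are harmless.\<close>

type_synonym 'a metric_form = "'a \<Rightarrow> 'a \<Rightarrow> 'a \<Rightarrow> real"

definition riem_length :: "'a::euclidean_space metric_form \<Rightarrow> (real \<Rightarrow> 'a) \<Rightarrow> ennreal" where
  "riem_length g \<gamma> =
     (\<integral>\<^sup>+ s \<in> {0..1}. ennreal (sqrt (g (\<gamma> s) (vector_derivative \<gamma> (at s)) (vector_derivative \<gamma> (at s))))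
       \<partial>lborel)"

definition riem_dist :: "'a::euclidean_space metric_form \<Rightarrow> 'a \<Rightarrow> 'a \<Rightarrow> ennreal" where
  "riem_dist g x y =
     Inf {riem_length g \<gamma> | \<gamma>.
            \<gamma> piecewise_C1_differentiable_on {0..1} \<and> pathstart \<gamma> = x \<and> pathfinish \<gamma> = y}"

definition riem_ball :: "'a::euclidean_space metric_form \<Rightarrow> 'a \<Rightarrow> real \<Rightarrow> 'a set" where
  "riem_ball g x r = {y. riem_dist g x y < ennreal r}"

text \<open>The coordinate frame of \<open>\<real>\<^sup>n \<times> \<real>\<close>: \<open>Some i\<close> indexes \<open>\<partial>/\<partial>x\<^sub>i\<close> and \<open>None\<close> indexes \<open>\<partial>/\<partial>t\<close>.\<close>

definition coord_frame :: "'n::finite option \<Rightarrow> (real ^ 'n) \<times> real" where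
  "coord_frame k = (case k of None \<Rightarrow> (0, 1) | Some i \<Rightarrow> (axis i 1, 0))"

definition riem_volume ::
  "((real ^ 'n) \<times> real) metric_form \<Rightarrow> ((real ^ 'n) \<times> real) measure" where
  "riem_volume g = density lborel (\<lambda>p. ennreal (sqrt
     (Determinants.det (\<chi> i j. g p (coord_frame i) (coord_frame j) :: real ^ ('n option) ^ ('n option)))))"

definition has_volume_entropy ::
  "((real ^ 'n) \<times> real) metric_form \<Rightarrow> real \<Rightarrow> bool" where
  "has_volume_entropy g \<delta> \<longleftrightarrow>
     (\<forall>x. ((\<lambda>r. ln (measure (riem_volume g) (riem_ball g x r)) / r) \<longlongrightarrow> \<delta>) at_top)"


section \<open>The group \<open>G(A)\<close> and its metric\<close>

definition heintze_mult ::
  "real ^ 'n ^ 'n \<Rightarrow> (real ^ 'n) \<times> real \<Rightarrow> (real ^ 'n) \<times> real \<Rightarrow> (real ^ 'n) \<times> real" where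
  "heintze_mult A p q = (fst p + matrix_exp (snd p *\<^sub>R A) *v fst q, snd p + snd q)"

definition left_invariant ::
  "real ^ 'n ^ 'n \<Rightarrow> ((real ^ 'n) \<times> real) metric_form \<Rightarrow> bool" where
  "left_invariant A g \<longleftrightarrow>
     (\<forall>p q v w. g (heintze_mult A p q)
        (frechet_derivative (heintze_mult A p) (at q) v)
        (frechet_derivative (heintze_mult A p) (at q) w) = g q v w)"

text \<open>The neutral element is \<open>0\<close>, so \<open>g 0\<close> is the inner product on the Lie algebra.\<close>

definition heintze_metric ::
  "real ^ 'n ^ 'n \<Rightarrow> ((real ^ 'n) \<times> real) metric_form \<Rightarrow> bool" where
  "heintze_metric A g \<longleftrightarrow>
     left_invariant A g \<and>
     inner_product_form (g 0) \<and>
     g 0 (0, 1) (0, 1) = 1 \<and>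
     (\<forall>v. g 0 (v, 0) (0, 1) = 0) \<and>
     (\<exists>b. real_jordan_basis A b \<and>
        (\<forall>i<CARD('n). \<forall>j<CARD('n). g 0 (b i, 0) (b j, 0) = (if i = j then 1 else 0)))"

end

theory Submission
  imports Defs "HOL-Real_Asymp.Real_Asymp"
begin

text \<open>
  Put \<open>h = tr A = tr J\<close> and \<open>N v = |v|\<close> for the inner product on \<open>\<real>\<^sup>n\<close>. By left invariance the
  metric at \<open>(x, t)\<close> has squared norm \<open>N (exp (-tA) v)\<^sup>2 + a\<^sup>2\<close> on \<open>(v, a)\<close>, and its volume form is
  a constant multiple of \<open>exp (-ht) dx dt\<close>. In the real Jordan basis the symmetric part of \<open>A\<close> is
  diagonal with the real parts of the eigenvalues as entries, so \<open>N (exp (-tA) v)\<close> is nonincreasing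
  in \<open>t\<close>.

  Upper bound: a path of length less than \<open>r\<close> from \<open>(x\<^sub>0, t\<^sub>0)\<close> to \<open>(x, t)\<close> stays below the height
  \<open>T = (r + t\<^sub>0 + t) / 2\<close>, whence \<open>N (exp (-TA) (x - x\<^sub>0)) \<le> r\<close>. The slice of the ball at height
  \<open>t\<close> therefore has Lebesgue measure \<open>O(r\<^sup>n exp (hT))\<close>, and integrating against \<open>exp (-ht)\<close> over
  \<open>|t - t\<^sub>0| \<le> r\<close> gives \<open>O(r\<^sup>n\<^sup>+\<^sup>1 exp (hr))\<close>.

  Lower bound: moving horizontally by less than \<open>1\<close> and then straight down, the ball reaches a box
  of fixed base at heights between \<open>t\<^sub>0 - r + 1\<close> and \<open>t\<^sub>0 - r + 2\<close>, whose volume is at least a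
  constant times \<open>exp (hr)\<close>.
\<close>

no_notation vec_index (infixl "$" 100)
no_notation scalar_prod (infix "\<bullet>" 70)

section \<open>The matrix exponential\<close>

abbreviation id_mat :: "real ^ 'n ^ 'n"
  where "id_mat \<equiv> Finite_Cartesian_Product.mat 1"

lemma has_vector_derivative_matrixI:
  fixes f :: "real \<Rightarrow> real ^ 'm ^ 'n"
  assumes "\<And>i j. ((\<lambda>t. f t $ i $ j) has_real_derivative d $ i $ j) (at x)"
  shows "(f has_vector_derivative d) (at x)"
  unfolding has_vector_derivative_def has_derivative_componentwise_within[of f]
proof
  fix b :: "real ^ 'm ^ 'n" assume "b \<in> Basis"
  then obtain i j where b: "b = axis i (axis j 1)"
    by (auto simp: Basis_vec_def)
  have "((\<lambda>t. f t $ i $ j) has_derivative (\<lambda>h. h * d $ i $ j)) (at x)"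
    using assms[of i j] by (simp add: has_field_derivative_def mult_commute_abs)
  then show "((\<lambda>x. f x \<bullet> b) has_derivative (\<lambda>x. x *\<^sub>R d \<bullet> b)) (at x)"
    by (simp add: b inner_axis)
qed

lemma bounded_bilinear_matrix_mult:
  "bounded_bilinear ((**) :: real ^ 'n ^ 'm \<Rightarrow> real ^ 'k ^ 'n \<Rightarrow> real ^ 'k ^ 'm)"
  unfolding bilinear_conv_bounded_bilinear[symmetric] bilinear_def
  by (auto intro!: linearI simp: matrix_matrix_mult_def Finite_Cartesian_Product.vec_eq_iff distrib_left distrib_right
      sum.distrib sum_distrib_left ac_simps)

lemma bounded_bilinear_matrix_vector_mult:
  "bounded_bilinear ((*v) :: real ^ 'n ^ 'm \<Rightarrow> real ^ 'n \<Rightarrow> real ^ 'm)"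
  unfolding bilinear_conv_bounded_bilinear[symmetric] bilinear_def
  by (auto intro!: linearI simp: matrix_vector_right_distrib matrix_vector_mult_add_rdistrib
      matrix_vector_mult_scaleR scaleR_matrix_vector_assoc)

definition matrix_power :: "real ^ 'n ^ 'n \<Rightarrow> nat \<Rightarrow> real ^ 'n ^ 'n"
  where "matrix_power A k = ((**) A ^^ k) id_mat"

lemma matrix_power_Suc: "matrix_power A (Suc k) = A ** matrix_power A k"
  by (simp add: matrix_power_def)

lemma matrix_power_scaleR: "matrix_power (t *\<^sub>R A) k = t ^ k *\<^sub>R matrix_power A k"
  by (induction k)
    (simp_all add: matrix_power_def bounded_bilinear.scaleR_left[OF bounded_bilinear_matrix_mult]
      bounded_bilinear.scaleR_right[OF bounded_bilinear_matrix_mult] ac_simps)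

text \<open>Boundedness of the matrix product supplies a constant \<open>K\<close> for which the
  powers grow at most geometrically, with ratio \<open>norm A * K\<close>; the scalar exponential
  series then dominates.\<close>

lemma summable_matrix_exp:
  fixes A :: "real ^ 'n ^ 'n"
  shows "summable (\<lambda>k. (1 / fact k) *\<^sub>R matrix_power A k)"
proof -
  obtain K where K: "K > 0"
    "\<And>(M :: real ^ 'n ^ 'n) (N :: real ^ 'n ^ 'n). norm (M ** N) \<le> norm M * norm N * K"
    using bounded_bilinear.pos_bounded[OF bounded_bilinear_matrix_mult] by blast
  define c where "c = norm (id_mat :: real ^ 'n ^ 'n)"
  have bound: "norm (matrix_power A k) \<le> c * (norm A * K) ^ k" for k
  proof (induction k)
    case 0
    then show ?case by (simp add: matrix_power_def c_def)
  next
    case (Suc k)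
    have "norm (matrix_power A (Suc k)) \<le> norm A * norm (matrix_power A k) * K"
      unfolding matrix_power_Suc by (rule K(2))
    also have "\<dots> \<le> norm A * (c * (norm A * K) ^ k) * K"
      using Suc K(1) by (intro mult_right_mono mult_left_mono) auto
    finally show ?case by (simp add: ac_simps)
  qed
  have "summable (\<lambda>k. c * (inverse (fact k) * (norm A * K) ^ k))"
    by (intro summable_mult summable_exp)
  then show ?thesis
  proof (rule summable_comparison_test'[where N = 0])
    fix k
    show "norm ((1 / fact k) *\<^sub>R matrix_power A k) \<le> c * (inverse (fact k) * (norm A * K) ^ k)"
      using mult_left_mono[OF bound[of k], of "inverse (fact k)"]
      by (simp add: field_simps)
  qed
qed

lemma matrix_exp_scaleR_sums:
  "(\<lambda>k. (t ^ k / fact k) *\<^sub>R matrix_power A k) sums matrix_exp (t *\<^sub>R A)"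
  using summable_sums[OF summable_matrix_exp[of "t *\<^sub>R A"]]
  by (simp add: matrix_exp_def matrix_power_scaleR flip: matrix_power_def)

lemma matrix_exp_zero [simp]: "matrix_exp 0 = id_mat"
proof -
  have "(\<lambda>k. (0 ^ k / fact k) *\<^sub>R matrix_power 0 k) sums
      (\<Sum>k\<in>{0}. (0 ^ k / fact k) *\<^sub>R matrix_power (0 :: real ^ 'a ^ 'a) k)"
    by (rule sums_finite) auto
  with matrix_exp_scaleR_sums[of 0 0] show ?thesis
    by (auto simp: matrix_power_def dest: sums_unique2)
qed

text \<open>Each entry is a scalar power series in \<open>t\<close> that converges everywhere, so it
  may be differentiated term by term; \<open>diffs\<close> shifts the coefficients by one, and the
  factor \<open>A\<close> absorbs the shift.\<close>

lemma matrix_exp_has_vector_derivative: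
  fixes A :: "real ^ 'n ^ 'n"
  shows "((\<lambda>t. matrix_exp (t *\<^sub>R A)) has_vector_derivative A ** matrix_exp (t *\<^sub>R A)) (at t)"
proof (rule has_vector_derivative_matrixI)
  fix i j
  define c where "c k = matrix_power A k $ i $ j / fact k" for k
  have sums: "(\<lambda>k. c k * t ^ k) sums (matrix_exp (t *\<^sub>R A) $ i $ j)" for t
    using sums_vec_nth[OF sums_vec_nth[OF matrix_exp_scaleR_sums[of t A], of i], of j]
    by (simp add: c_def mult.commute)
  have "((\<lambda>t. \<Sum>k. c k * t ^ k) has_real_derivative (\<Sum>k. diffs c k * t ^ k)) (at t)"
    using sums by (intro termdiffs_strong_converges_everywhere) (auto simp: sums_iff)
  moreover have "(\<lambda>k. diffs c k * t ^ k) sums ((A ** matrix_exp (t *\<^sub>R A)) $ i $ j)"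
  proof -
    have "(\<lambda>k. A ** ((t ^ k / fact k) *\<^sub>R matrix_power A k)) sums (A ** matrix_exp (t *\<^sub>R A))"
      by (rule bounded_linear.sums[OF bounded_bilinear.bounded_linear_right
            [OF bounded_bilinear_matrix_mult] matrix_exp_scaleR_sums])
    then have "(\<lambda>k. (A ** ((t ^ k / fact k) *\<^sub>R matrix_power A k)) $ i $ j) sums
        ((A ** matrix_exp (t *\<^sub>R A)) $ i $ j)"
      by (intro sums_vec_nth)
    moreover have "(A ** ((t ^ k / fact k) *\<^sub>R matrix_power A k)) $ i $ j = diffs c k * t ^ k" for k
      by (simp add: bounded_bilinear.scaleR_right[OF bounded_bilinear_matrix_mult]
          matrix_power_Suc[symmetric] diffs_def c_def divide_simps)
    ultimately show ?thesis by simp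
  qed
  ultimately show "((\<lambda>t. matrix_exp (t *\<^sub>R A) $ i $ j) has_real_derivative
      (A ** matrix_exp (t *\<^sub>R A)) $ i $ j) (at t)"
    using sums by (simp add: sums_iff)
qed

lemma matrix_exp_commute: "A ** matrix_exp (t *\<^sub>R A) = matrix_exp (t *\<^sub>R A) ** A"
proof -
  have comm: "A ** matrix_power A k = matrix_power A k ** A" for k
    by (induction k) (simp_all add: matrix_power_def, metis matrix_mul_assoc)
  have "(\<lambda>k. A ** ((t ^ k / fact k) *\<^sub>R matrix_power A k)) sums (A ** matrix_exp (t *\<^sub>R A))"
    by (rule bounded_linear.sums[OF bounded_bilinear.bounded_linear_right
          [OF bounded_bilinear_matrix_mult] matrix_exp_scaleR_sums])
  moreover have "(\<lambda>k. ((t ^ k / fact k) *\<^sub>R matrix_power A k) ** A) sums (matrix_exp (t *\<^sub>R A) ** A)"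
    by (rule bounded_linear.sums[OF bounded_bilinear.bounded_linear_left
          [OF bounded_bilinear_matrix_mult] matrix_exp_scaleR_sums])
  ultimately show ?thesis
    by (simp add: bounded_bilinear.scaleR_right[OF bounded_bilinear_matrix_mult]
        bounded_bilinear.scaleR_left[OF bounded_bilinear_matrix_mult] comm sums_iff)
qed

text \<open>The product has derivative zero in \<open>t\<close>, since \<open>A\<close> commutes
  with its exponential and the two contributions cancel, so it keeps its value at
  \<open>t = 0\<close>. The parameter \<open>s\<close> lets this one identity yield both the inverse
  and the addition law.\<close>

lemma matrix_exp_shift:
  fixes A :: "real ^ 'n ^ 'n"
  shows "matrix_exp (- t *\<^sub>R A) ** matrix_exp ((t + s) *\<^sub>R A) = matrix_exp (s *\<^sub>R A)"
proof -
  define F where "F t = matrix_exp (- t *\<^sub>R A) ** matrix_exp ((t + s) *\<^sub>R A)" for t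
  have d: "(F has_vector_derivative 0) (at t)" for t
  proof -
    have 1: "((\<lambda>t. matrix_exp (- t *\<^sub>R A)) has_vector_derivative
        - (A ** matrix_exp (- t *\<^sub>R A))) (at t)"
      using vector_diff_chain_at[OF has_vector_derivative_minus[OF has_vector_derivative_id]
          matrix_exp_has_vector_derivative[where A = A], of t]
      by (simp add: o_def)
    have 2: "((\<lambda>t. matrix_exp ((t + s) *\<^sub>R A)) has_vector_derivative
        A ** matrix_exp ((t + s) *\<^sub>R A)) (at t)"
      using vector_diff_chain_at[OF has_vector_derivative_add_const[THEN iffD2, OF has_vector_derivative_id]
          matrix_exp_has_vector_derivative[where A = A], of s t]
      by (simp add: o_def)
    show ?thesis
      using bounded_bilinear.has_vector_derivative[OF bounded_bilinear_matrix_mult 1 2]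
      unfolding F_def
      by (simp add: matrix_exp_commute[of A "- t", simplified] matrix_mul_assoc
          bounded_bilinear.minus_left[OF bounded_bilinear_matrix_mult])
  qed
  have "F t = F 0"
    by (rule has_vector_derivative_zero_constant[of UNIV F]) (auto intro: d) 
  then show ?thesis
    by (simp add: F_def)
qed

lemma matrix_exp_inverse:
  "matrix_exp (- t *\<^sub>R A) ** matrix_exp (t *\<^sub>R A) = id_mat"
  "matrix_exp (t *\<^sub>R A) ** matrix_exp (- t *\<^sub>R A) = id_mat"
  using matrix_exp_shift[of t A 0] matrix_exp_shift[of "- t" A 0] by simp_all

lemma matrix_exp_add:
  "matrix_exp ((s + t) *\<^sub>R A) = matrix_exp (s *\<^sub>R A) ** matrix_exp (t *\<^sub>R A)"
  by (metis matrix_exp_inverse(2) matrix_exp_shift matrix_mul_assoc matrix_mul_lid)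

section \<open>Determinants and linear images\<close>

text \<open>In the Leibniz expansion at the identity only \<open>p = id\<close> survives
  differentiation: any other permutation moves at least two indices, so dropping one factor of its
  product still leaves an off-diagonal zero.\<close>

lemma det_derivative_at_id:
  fixes M :: "real \<Rightarrow> real ^ 'm ^ 'm"
  assumes M0: "M 0 = id_mat" and d: "(M has_vector_derivative D) (at 0)"
  shows "((\<lambda>t. Determinants.det (M t)) has_real_derivative trace D) (at 0)"
proof -
  have entry: "((\<lambda>t. M t $ i $ j) has_real_derivative D $ i $ j) (at 0)" for i j
    using bounded_linear.has_vector_derivative[OF bounded_linear_vec_nth
        bounded_linear.has_vector_derivative[OF bounded_linear_vec_nth d]]
    by (simp add: has_real_derivative_iff_has_vector_derivative)
  let ?P = "{p. p permutes (UNIV :: 'm set)}"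
  let ?d = "\<lambda>p. of_int (sign p) * (\<Sum>i\<in>UNIV. D $ i $ p i * (\<Prod>k\<in>UNIV - {i}. M 0 $ k $ p k))"
  have "((\<lambda>t. Determinants.det (M t)) has_real_derivative (\<Sum>p\<in>?P. ?d p)) (at 0)"
    unfolding Determinants.det_def
    by (intro DERIV_sum DERIV_cmult has_field_derivative_prod entry)
  moreover have "?d p = 0" if p: "p \<in> ?P - {id}" for p
  proof -
    from p have perm: "p permutes UNIV" and "p \<noteq> id" by auto
    have "(\<Prod>k\<in>UNIV - {i}. M 0 $ k $ p k) = 0" for i
    proof -
      have "\<exists>k. k \<noteq> i \<and> p k \<noteq> k"
      proof (rule ccontr)
        assume "\<not> ?thesis"
        then have fixed: "\<And>k. k \<noteq> i \<Longrightarrow> p k = k" by auto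
        then have "p i = i"
          using permutes_inj[OF perm] by (metis injD)
        with fixed have "p = id" by (metis eq_id_iff)
        with \<open>p \<noteq> id\<close> show False by simp
      qed
      then obtain k where "k \<noteq> i" "p k \<noteq> k" by blast
      then show ?thesis
        by (intro prod_zero) (auto simp: M0 Finite_Cartesian_Product.mat_def intro!: bexI[of _ k])
    qed
    then show ?thesis
      by (simp only: mult_zero_right sum.neutral_const)
  qed
  then have "(\<Sum>p\<in>?P. ?d p) = (\<Sum>p\<in>{id}. ?d p)"
    by (intro sum.mono_neutral_right finite_permutations) (auto simp: permutes_id)
  moreover have "\<dots> = trace D"
    by (simp add: trace_def M0 Finite_Cartesian_Product.mat_def)
  ultimately show ?thesis by simp
qed

text \<open>Multiplicativity of the determinant spreads its derivative at \<open>0\<close> to every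
  \<open>t\<close>, which gives a linear differential equation with rate \<open>trace D\<close> and
  initial value \<open>1\<close>. It serves both for \<open>matrix_exp\<close> and for the left
  translations of the group.\<close>

lemma det_one_parameter_group:
  fixes M :: "real \<Rightarrow> real ^ 'm ^ 'm"
  assumes add: "\<And>s t. M (s + t) = M s ** M t" and M0: "M 0 = id_mat"
    and d: "(M has_vector_derivative D) (at 0)"
  shows "Determinants.det (M t) = exp (t * trace D)"
proof -
  define f where "f t = Determinants.det (M t)" for t
  have f': "(f has_real_derivative trace D * f t) (at t)" for t
  proof -
    have "((\<lambda>s. f t * f s) has_real_derivative f t * trace D) (at 0)"
      unfolding f_def by (intro DERIV_cmult det_derivative_at_id M0 d)
    moreover have "f t * f s = f (t + s)" for s
      by (simp add: f_def add det_mul)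
    ultimately show ?thesis
      using DERIV_shift[of f "trace D * f t" 0 t] by (simp add: ac_simps)
  qed
  have d0: "((\<lambda>t. f t * exp (- (t * trace D))) has_real_derivative 0) (at t)" for t
    by (rule derivative_eq_intros f' refl | simp)+
  have "f t * exp (- (t * trace D)) = f 0 * exp (- (0 * trace D))"
    by (rule DERIV_isconst_all) (auto intro: d0)
  then show ?thesis
    by (simp add: f_def M0 exp_minus field_simps)
qed

lemma det_matrix_exp: "Determinants.det (matrix_exp (t *\<^sub>R A)) = exp (t * trace A)"
  using matrix_exp_has_vector_derivative[where t = 0]
  by (intro det_one_parameter_group[where M = "\<lambda>t. matrix_exp (t *\<^sub>R A)"] matrix_exp_add) simp_all

text \<open>The segment from the identity to \<open>G\<close> consists of positive definite, hence
  invertible, matrices; a determinant that starts at \<open>1\<close> and never vanishes along it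
  stays positive by the intermediate value theorem.\<close>

lemma det_positive_definite:
  fixes G :: "real ^ 'm ^ 'm"
  assumes pos: "\<And>v. v \<noteq> 0 \<Longrightarrow> v \<bullet> (G *v v) > 0"
  shows "Determinants.det G > 0"
proof (rule ccontr)
  define H where "H s = (1 - s) *\<^sub>R id_mat + s *\<^sub>R G" for s
  have Hv: "H s *v v = (1 - s) *\<^sub>R v + s *\<^sub>R (G *v v)" for s v
    by (simp add: H_def matrix_vector_mult_add_rdistrib flip: scaleR_matrix_vector_assoc)
  have nz: "Determinants.det (H s) \<noteq> 0" if s: "0 \<le> s" "s \<le> 1" for s
  proof -
    have "v = 0" if "H s *v v = 0" for v
    proof (rule ccontr)
      assume "v \<noteq> 0"
      then have "0 < (1 - s) * (v \<bullet> v) + s * (v \<bullet> (G *v v))"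
        using s pos[of v] by (cases "s = 0") (auto intro!: add_nonneg_pos)
      also have "\<dots> = v \<bullet> (H s *v v)"
        by (simp add: Hv inner_add_right)
      finally show False using that by simp
    qed
    then have "inj ((*v) (H s))"
      by (simp add: linear_injective_0)
    then show ?thesis
      using det_nz_iff_inj[of "(*v) (H s)"] by simp
  qed
  have cont: "continuous_on {0..1} (\<lambda>s. Determinants.det (H s))"
    unfolding Determinants.det_def H_def by (intro continuous_intros)
  assume "\<not> Determinants.det G > 0"
  then have "Determinants.det (H 1) \<le> 0" by (simp add: H_def)
  moreover have "0 \<le> Determinants.det (H 0)" by (simp add: H_def)
  ultimately obtain s where "0 \<le> s" "s \<le> 1" "Determinants.det (H s) = 0"
    using IVT2'[of "\<lambda>s. Determinants.det (H s)" 1 0 0] cont by auto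
  with nz show False by blast
qed

text \<open>The library proves this only for well-ordered index types, since it computes the determinant
  of a shear as that of a triangular matrix; a row operation does not need the order.\<close>

lemma lmeasurable_linear_image_cart:
  fixes f :: "real ^ 'n \<Rightarrow> real ^ 'n"
  assumes "linear f"
  shows "\<forall>S\<in>lmeasurable. f ` S \<in> lmeasurable \<and>
    measure lebesgue (f ` S) = \<bar>Determinants.det (matrix f)\<bar> * measure lebesgue S"
    (is "?P f")
proof -
  \<comment> \<open>For maps of determinant \<open>1\<close> or \<open>-1\<close>,
    \<open>measure_linear_sufficient\<close> reduces the claim to boxes; the transposition and the
    shear below are treated this way.\<close>
  have boxes: "?P h" if "linear h" "\<bar>Determinants.det (matrix h)\<bar> = 1"
    "\<And>a b. measure lebesgue (h ` cbox a b) = measure lebesgue (cbox a b)" for h :: "real ^ 'n \<Rightarrow> real ^ 'n"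
  proof
    fix S :: "(real ^ 'n) set" assume "S \<in> lmeasurable"
    from measure_linear_sufficient[OF that(1) this, of 1] that(3)
    have "h ` S \<in> lmeasurable \<and> 1 * measure lebesgue S = measure lebesgue (h ` S)" by simp
    then show "h ` S \<in> lmeasurable \<and>
        measure lebesgue (h ` S) = \<bar>Determinants.det (matrix h)\<bar> * measure lebesgue S"
      unfolding that(2) by metis
  qed
  show ?thesis
  proof (rule induct_linear_elementary[OF assms])
    fix f h :: "real ^ 'n \<Rightarrow> real ^ 'n"
    assume fh: "linear f" "linear h" "?P f" "?P h"
    show "?P (f \<circ> h)"
    proof
      fix S :: "(real ^ 'n) set" assume "S \<in> lmeasurable"
      with fh show "(f \<circ> h) ` S \<in> lmeasurable \<and>
          measure lebesgue ((f \<circ> h) ` S) = \<bar>Determinants.det (matrix (f \<circ> h))\<bar> * measure lebesgue S"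
        unfolding image_comp[symmetric] by (simp add: matrix_compose det_mul abs_mult)
    qed
  next
    fix f :: "real ^ 'n \<Rightarrow> real ^ 'n" and i
    assume f: "linear f" "\<And>x. f x $ i = 0"
    \<comment> \<open>A map that kills coordinate \<open>i\<close> is not onto, hence singular, and
      both sides of the claim are zero.\<close>
    have "axis i 1 \<notin> range f"
    proof
      assume "axis i 1 \<in> range f"
      then obtain x where "f x = axis i 1" by (auto simp: image_iff)
      with f(2)[of x] show False by simp
    qed
    then have "\<not> inj f"
      using linear_injective_imp_surjective[OF f(1)] by auto
    then have "Determinants.det (matrix f) = 0" "negligible (f ` S)" for S
      using det_nz_iff_inj[OF f(1)] negligible_linear_singular_image[OF f(1)] by auto
    then show "?P f"
      by (simp add: negligible_iff_measure)
  next
    fix c :: "'n \<Rightarrow> real"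
    have "Determinants.det (matrix (\<lambda>x. \<chi> i. c i * x $ i)) = prod c UNIV"
      by (subst det_diagonal) (auto simp: matrix_def axis_def)
    then show "?P (\<lambda>x. \<chi> i. c i * x $ i)"
      by (simp add: measurable_stretch measure_stretch)
  next
    fix m n :: 'n assume "m \<noteq> n"
    let ?t = "Transposition.transpose m n"
    let ?h = "\<lambda>x :: real ^ 'n. \<chi> i. x $ ?t i"
    have "linear ?h"
      by (rule linearI) (simp_all add: Finite_Cartesian_Product.vec_eq_iff)
    moreover have "\<bar>Determinants.det (matrix ?h)\<bar> = 1"
    proof -
      have "matrix ?h = (\<chi> i. id_mat $ ?t i)"
        by (auto simp: matrix_def Finite_Cartesian_Product.mat_def axis_def Finite_Cartesian_Product.vec_eq_iff)
      then show ?thesis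
        using Determinants.det_permute_rows[of ?t "id_mat :: real ^ 'n ^ 'n"] \<open>m \<noteq> n\<close>
        by (simp add: permutes_swap_id sign_swap_id)
    qed
    moreover have "measure lebesgue (?h ` cbox a b) = measure lebesgue (cbox a b)" for a b
    proof -
      have "?h ` cbox a b = cbox (?h a) (?h b)"
      proof safe
        fix y assume "y \<in> cbox (?h a) (?h b)"
        then have "\<forall>i. a $ ?t i \<le> y $ i \<and> y $ i \<le> b $ ?t i" by (simp add: mem_box_cart)
        then have "\<forall>i. a $ i \<le> y $ ?t i \<and> y $ ?t i \<le> b $ i" by (metis transpose_involutory)
        then have "?h y \<in> cbox a b" by (simp add: mem_box_cart)
        moreover have "y = ?h (?h y)" by (simp add: Finite_Cartesian_Product.vec_eq_iff)
        ultimately show "y \<in> ?h ` cbox a b" by blast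
      qed (simp add: mem_box_cart)
      moreover have "(\<Prod>i\<in>UNIV. b $ ?t i - a $ ?t i) = (\<Prod>i\<in>UNIV. b $ i - a $ i)"
        by (rule prod.reindex_bij_betw) simp
      moreover have "cbox (?h a) (?h b) = {} \<longleftrightarrow> cbox a b = {}"
        using \<open>?h ` cbox a b = cbox (?h a) (?h b)\<close> by (metis image_is_empty)
      ultimately show ?thesis
        by (simp add: content_cbox_if_cart)
    qed
    ultimately show "?P ?h" by (rule boxes)
  next
    fix m n :: 'n assume "m \<noteq> n"
    let ?h = "\<lambda>x :: real ^ 'n. \<chi> i. if i = m then x $ m + x $ n else x $ i"
    have lin: "linear ?h"
      by (rule linearI) (simp_all add: Finite_Cartesian_Product.vec_eq_iff algebra_simps)
    moreover have "\<bar>Determinants.det (matrix ?h)\<bar> = 1"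
    proof -
      have "matrix ?h = (\<chi> i. if i = m then Finite_Cartesian_Product.row m id_mat + 1 *s Finite_Cartesian_Product.row n id_mat
          else Finite_Cartesian_Product.row i id_mat)"
        by (auto simp: matrix_def Finite_Cartesian_Product.mat_def axis_def Finite_Cartesian_Product.row_def
            Finite_Cartesian_Product.vec_eq_iff)
      then show ?thesis
        using Determinants.det_row_operation[OF \<open>m \<noteq> n\<close>, of "id_mat :: real ^ 'n ^ 'n" 1] by simp
    qed
    moreover have "measure lebesgue (?h ` cbox a b) = measure lebesgue (cbox a b)" for a b
    proof (cases "cbox a b = {}")
      case False
      \<comment> \<open>The box is moved to lower corner \<open>0\<close>, where the sign condition
        of \<open>measure_shear_interval\<close> holds.\<close>
      have box: "cbox a b = (+) a ` cbox 0 (b - a)"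
        using cbox_translation[of a 0 "b - a"] by simp
      have "?h ` cbox a b = (+) (?h a) ` ?h ` cbox 0 (b - a)"
        unfolding box image_image linear_add[OF lin] ..
      then have "measure lebesgue (?h ` cbox a b) = measure lebesgue (?h ` cbox 0 (b - a))"
        by (simp only: measure_translation)
      also have "\<dots> = measure lebesgue (cbox 0 (b - a))"
        using False box by (intro measure_shear_interval \<open>m \<noteq> n\<close>) auto
      also have "\<dots> = measure lebesgue (cbox a b)"
        unfolding box by (rule measure_translation[symmetric])
      finally show ?thesis .
    qed simp
    ultimately show "?P ?h" by (rule boxes)
  qed
qed

section \<open>Jordan forms\<close>

lemma bij_betw_index_enum: "bij_betw (index_enum :: nat \<Rightarrow> 'n::finite) {..<CARD('n)} UNIV"
proof -
  have "\<exists>e. bij_betw e {..<CARD('n)} (UNIV :: 'n set)"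
    using ex_bij_betw_nat_finite[of "UNIV :: 'n set"] by (simp add: lessThan_atLeast0)
  then show ?thesis
    unfolding index_enum_def by (rule someI_ex)
qed

lemma sum_index_enum: "(\<Sum>i<CARD('n). f (index_enum i :: 'n::finite)) = (\<Sum>i\<in>UNIV. f i)"
  by (rule sum.reindex_bij_betw[OF bij_betw_index_enum])

section \<open>Traces of complex matrices and of Jordan matrices\<close>

lemma mat_trace_mult_commute:
  fixes A B :: "'a :: comm_semiring_0 mat"
  assumes "A \<in> carrier_mat n m" "B \<in> carrier_mat m n"
  shows "mat_trace (A * B) = mat_trace (B * A)"
proof -
  have "mat_trace (A * B) = (\<Sum>i<n. \<Sum>j<m. A $$ (i, j) * B $$ (j, i))"
    using assms by (auto simp: mat_trace_def scalar_prod_def lessThan_atLeast0 intro!: sum.cong)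
  also have "\<dots> = (\<Sum>j<m. \<Sum>i<n. B $$ (j, i) * A $$ (i, j))"
    by (subst sum.swap) (simp add: mult.commute)
  also have "\<dots> = mat_trace (B * A)"
    using assms by (auto simp: mat_trace_def scalar_prod_def lessThan_atLeast0 intro!: sum.cong)
  finally show ?thesis .
qed

lemma mat_trace_similar:
  fixes A B :: "'a :: comm_semiring_1 mat"
  assumes "similar_mat A B"
  shows "mat_trace A = mat_trace B"
proof -
  obtain P Q n where "A = P * B * Q" "Q * P = 1\<^sub>m n"
    "P \<in> carrier_mat n n" "Q \<in> carrier_mat n n" "B \<in> carrier_mat n n"
    using similar_matD[OF assms] by blast
  then show ?thesis
    using mat_trace_mult_commute[of "P * B" n n Q] assoc_mult_mat[of Q n n P n B n] by simp
qed

lemma mat_trace_complex_mat_of: "mat_trace (complex_mat_of A) = complex_of_real (trace A)"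
proof -
  have "mat_trace (complex_mat_of A) = (\<Sum>i<CARD('a). complex_of_real (A $ index_enum i $ index_enum i))"
    by (simp add: mat_trace_def complex_mat_of_def)
  then show ?thesis
    by (simp add: sum_index_enum[of "\<lambda>i. complex_of_real (A $ i $ i)"] trace_def)
qed

text \<open>Lets the final theorem read the sign of the trace off the real parts of the
  eigenvalues.\<close>

lemma mat_trace_jordan_matrix:
  "mat_trace (jordan_matrix n_as) = (\<Sum>(n, a)\<leftarrow>n_as. of_nat n * a)"
proof (induction n_as)
  case Nil
  then show ?case by (simp add: mat_trace_def jordan_matrix_def)
next
  case (Cons na n_as)
  obtain n a where na: "na = (n, a)" by fastforce
  let ?J = "jordan_matrix n_as"
  let ?N = "dim_row ?J"
  have J: "?J \<in> carrier_mat ?N ?N"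
    by (metis carrier_matI jordan_matrix_dim)
  have "mat_trace (jordan_matrix (na # n_as)) =
      (\<Sum>i<n + ?N. if i < n then a else ?J $$ (i - n, i - n))"
    unfolding mat_trace_def jordan_matrix_Cons na using J
    by (auto simp: jordan_block_def intro!: sum.cong)
  also have "{..<n + ?N} = {..<n} \<union> {n..<n + ?N}" by auto
  also have "(\<Sum>i\<in>{..<n} \<union> {n..<n + ?N}. if i < n then a else ?J $$ (i - n, i - n)) =
      (\<Sum>i<n. a) + (\<Sum>i=n..<n + ?N. ?J $$ (i - n, i - n))"
    by (subst sum.union_disjoint) (auto intro!: arg_cong2[of _ _ _ _ "(+)"] sum.cong)
  also have "(\<Sum>i=n..<n + ?N. ?J $$ (i - n, i - n)) = (\<Sum>i<?N. ?J $$ (i, i))"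
    by (rule sum.reindex_bij_witness[of _ "\<lambda>i. i + n" "\<lambda>i. i - n"]) auto
  finally show ?case
    using Cons by (simp add: na mat_trace_def)
qed

section \<open>Eigenvalues read off complex and real Jordan forms\<close>

lemma jordan_nf_eigenvalue:
  fixes A :: "complex mat"
  assumes "A \<in> carrier_mat m m" "jordan_nf A n_as" "(n, a) \<in> set n_as"
  shows "eigenvalue A a"
proof -
  \<comment> \<open>A block of size \<open>0\<close> would contribute the factor \<open>1\<close> to
    the characteristic polynomial and no root; \<open>jordan_nf\<close> excludes it.\<close>
  have "n \<noteq> 0" using assms(2,3) unfolding jordan_nf_def by force
  then have "poly (char_poly A) a = 0"
    using assms(3) unfolding jordan_nf_char_poly[OF assms(2)] 
    by (force simp: poly_prod_list prod_list_zero_iff)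
  then show ?thesis
    using eigenvalue_root_char_poly[OF assms(1)] by simp
qed

text \<open>The complex vector \<open>u - i v\<close> is an eigenvector, and
  \<open>u \<noteq> 0\<close> makes its real part nonzero. With \<open>v = 0\<close> and \<beta>
  zero this also covers real eigenvalues.\<close>

lemma eigenvalue_complex_mat_of:
  fixes A :: "real ^ 'n ^ 'n"
  assumes u: "A *v u = \<alpha> *\<^sub>R u + \<beta> *\<^sub>R v" and v: "A *v v = \<alpha> *\<^sub>R v - \<beta> *\<^sub>R u" and "u \<noteq> 0"
  shows "eigenvalue (complex_mat_of A) (Complex \<alpha> \<beta>)"
proof -
  define w where "w = (\<lambda>i. Complex (u $ i) (- v $ i))"
  define z where "z = Matrix.vec CARD('n) (\<lambda>k. w (index_enum k))"
  have row: "(\<Sum>j\<in>UNIV. complex_of_real (A $ i $ j) * w j) = Complex \<alpha> \<beta> * w i" for i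
  proof -
    have "(A *v u) $ i = \<alpha> * u $ i + \<beta> * v $ i" "(A *v v) $ i = \<alpha> * v $ i - \<beta> * u $ i"
      by (simp_all add: u v)
    then show ?thesis
      by (simp add: complex_eq_iff w_def matrix_vector_mult_def sum_negf algebra_simps)
  qed
  have "complex_mat_of A *\<^sub>v z = Complex \<alpha> \<beta> \<cdot>\<^sub>v z"
  proof (rule eq_vecI)
    fix k assume "k < dim_vec (Complex \<alpha> \<beta> \<cdot>\<^sub>v z)"
    then have k: "k < CARD('n)" by (simp add: z_def)
    have "vec_index (complex_mat_of A *\<^sub>v z) k =
        (\<Sum>l<CARD('n). complex_of_real (A $ index_enum k $ index_enum l) * w (index_enum l))"
      using k by (auto simp: complex_mat_of_def z_def scalar_prod_def lessThan_atLeast0 intro!: sum.cong)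
    also have "\<dots> = Complex \<alpha> \<beta> * w (index_enum k)"
      by (simp add: sum_index_enum[of "\<lambda>l. complex_of_real (A $ index_enum k $ l) * w l"] row)
    finally show "vec_index (complex_mat_of A *\<^sub>v z) k = vec_index (Complex \<alpha> \<beta> \<cdot>\<^sub>v z) k"
      using k by (simp add: z_def)
  qed (simp add: complex_mat_of_def z_def)
  moreover have "z \<noteq> 0\<^sub>v CARD('n)"
  proof
    assume z0: "z = 0\<^sub>v CARD('n)"
    have "u $ i = 0" for i
    proof -
      obtain k where k: "k < CARD('n)" "i = index_enum k"
        using bij_betw_index_enum[where 'n = 'n] by (auto simp: bij_betw_def)
      then have "vec_index z k = 0" using z0 by simp
      then show ?thesis using k by (simp add: z_def w_def complex_eq_iff)
    qed
    with \<open>u \<noteq> 0\<close> show False by (simp add: Finite_Cartesian_Product.vec_eq_iff)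
  qed
  moreover have "z \<in> carrier_vec CARD('n)" by (simp add: z_def)
  ultimately show ?thesis
    unfolding eigenvalue_def eigenvector_def by (auto simp: complex_mat_of_def)
qed

text \<open>Keeps what remains of the block shape once the block positions are forgotten, in a form
  stable under block sums. Antisymmetry off the diagonal reduces the quadratic form of
  \<open>D\<close> to its diagonal; the alternative on columns exhibits an invariant line or plane,
  and so an eigenvalue with real part \<open>D $$ (i, i)\<close>.\<close>

definition real_jordan_form :: "real mat \<Rightarrow> bool" where
  "real_jordan_form D \<longleftrightarrow> square_mat D \<and>
     (\<forall>i<dim_row D. \<forall>j<dim_row D. i \<noteq> j \<longrightarrow> D $$ (i, j) + D $$ (j, i) = 0) \<and>
     (\<forall>i<dim_row D. (\<forall>k<dim_row D. k \<noteq> i \<longrightarrow> D $$ (k, i) = 0) \<or>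
        (\<exists>j<dim_row D. j \<noteq> i \<and> D $$ (j, j) = D $$ (i, i) \<and>
           (\<forall>k<dim_row D. k \<noteq> i \<longrightarrow> k \<noteq> j \<longrightarrow> D $$ (k, i) = 0 \<and> D $$ (k, j) = 0)))"

lemma real_jordan_form_block:
  assumes "D \<in> real_jordan_blocks"
  shows "real_jordan_form D"
proof -
  consider \<alpha> where "D = mat_of_rows_list 1 [[\<alpha>]]"
    | \<alpha> \<beta> where "D = mat_of_rows_list 2 [[\<alpha>, - \<beta>], [\<beta>, \<alpha>]]"
    using assms by (auto simp: real_jordan_blocks_def)
  then show ?thesis
  proof cases
    case 1
    then show ?thesis
      by (simp add: real_jordan_form_def mat_of_rows_list_def)
  next
    case 2
    have lt2: "k < dim_row D \<longleftrightarrow> k = 0 \<or> k = 1" for k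
      by (auto simp: 2 mat_of_rows_list_def)
    have ents: "square_mat D" "D $$ (0, 0) = \<alpha>" "D $$ (0, 1) = - \<beta>" "D $$ (1, 0) = \<beta>" "D $$ (1, 1) = \<alpha>"
      by (simp_all add: 2 mat_of_rows_list_def)
    have "\<exists>j<dim_row D. j \<noteq> i \<and> D $$ (j, j) = D $$ (i, i) \<and>
        (\<forall>k<dim_row D. k \<noteq> i \<longrightarrow> k \<noteq> j \<longrightarrow> D $$ (k, i) = 0 \<and> D $$ (k, j) = 0)" if "i < dim_row D" for i
      \<comment> \<open>In a block of size two the partner of index \<open>i\<close> is
        \<open>1 - i\<close>.\<close>
      using that ents unfolding lt2 by (intro exI[of _ "1 - i"]) auto
    moreover have "D $$ (i, j) + D $$ (j, i) = 0" if "i < dim_row D" "j < dim_row D" "i \<noteq> j" for i j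
      using that ents unfolding lt2 by auto
    ultimately show ?thesis
      using ents(1) unfolding real_jordan_form_def by blast
  qed
qed

lemma real_jordan_form_four_block:
  assumes A: "real_jordan_form A" and B: "real_jordan_form B"
  shows "real_jordan_form (four_block_mat A (0\<^sub>m (dim_row A) (dim_col B)) (0\<^sub>m (dim_row B) (dim_col A)) B)"
    (is "real_jordan_form ?D")
proof -
  let ?n = "dim_row A" and ?m = "dim_row B"
  have sq: "dim_col A = ?n" "dim_col B = ?m"
    using A B by (auto simp: real_jordan_form_def)
  have D: "?D $$ (i, j) = (if i < ?n then if j < ?n then A $$ (i, j) else 0
      else if j < ?n then 0 else B $$ (i - ?n, j - ?n))" if "i < ?n + ?m" "j < ?n + ?m" for i j
    using that sq by auto
  have antisym: "?D $$ (i, j) + ?D $$ (j, i) = 0" if "i < ?n + ?m" "j < ?n + ?m" "i \<noteq> j" for i j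
    unfolding D[OF that(1,2)] D[OF that(2,1)] using that A B by (auto simp: real_jordan_form_def)
  have col: "(\<forall>k<?n + ?m. k \<noteq> i \<longrightarrow> ?D $$ (k, i) = 0) \<or>
        (\<exists>j<?n + ?m. j \<noteq> i \<and> ?D $$ (j, j) = ?D $$ (i, i) \<and>
           (\<forall>k<?n + ?m. k \<noteq> i \<longrightarrow> k \<noteq> j \<longrightarrow> ?D $$ (k, i) = 0 \<and> ?D $$ (k, j) = 0))"
    if i: "i < ?n + ?m" for i
  proof (cases "i < ?n")
    case True
    consider "\<forall>k<?n. k \<noteq> i \<longrightarrow> A $$ (k, i) = 0"
      | j where "j < ?n" "j \<noteq> i" "A $$ (j, j) = A $$ (i, i)"
          "\<forall>k<?n. k \<noteq> i \<longrightarrow> k \<noteq> j \<longrightarrow> A $$ (k, i) = 0 \<and> A $$ (k, j) = 0"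
      using A True unfolding real_jordan_form_def by blast
    then show ?thesis
    proof cases
      case 1
      then show ?thesis using True by (auto simp: D)
    next
      case 2
      then show ?thesis using True by (intro disjI2 exI[of _ j]) (auto simp: D)
    qed
  next
    case False
    then have "i - ?n < ?m" using i by auto
    then consider "\<forall>k<?m. k \<noteq> i - ?n \<longrightarrow> B $$ (k, i - ?n) = 0"
      | j where "j < ?m" "j \<noteq> i - ?n" "B $$ (j, j) = B $$ (i - ?n, i - ?n)"
          "\<forall>k<?m. k \<noteq> i - ?n \<longrightarrow> k \<noteq> j \<longrightarrow> B $$ (k, i - ?n) = 0 \<and> B $$ (k, j) = 0"
      using B unfolding real_jordan_form_def by blast
    then show ?thesis
    proof cases
      case 1
      then show ?thesis using False i by (auto simp: D)
    next
      case 2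
      \<comment> \<open>Indices of \<open>B\<close> are shifted by \<open>?n\<close> in the block
        sum, and the partner moves along with them.\<close>
      then show ?thesis using False i by (intro disjI2 exI[of _ "j + ?n"]) (auto simp: D)
    qed
  qed
  show ?thesis
    unfolding real_jordan_form_def index_mat_four_block(2,3) square_mat.simps
    by (intro conjI allI impI antisym col) (auto simp only: sq)
qed

lemma real_jordan_form_diag_block_mat:
  "set Bs \<subseteq> real_jordan_blocks \<Longrightarrow> real_jordan_form (diag_block_mat Bs)"
proof (induction Bs)
  case Nil
  then show ?case by (simp add: real_jordan_form_def)
next
  case (Cons B Bs)
  then have "real_jordan_form B" "real_jordan_form (diag_block_mat Bs)"
    by (auto intro: real_jordan_form_block)
  then show ?case
    by (simp add: Let_def real_jordan_form_four_block)
qed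

text \<open>Every diagonal entry of \<open>D\<close> is the real part of an eigenvalue of
  \<open>A\<close>: \<open>b i\<close>, alone or with its partner \<open>b j\<close>, spans an
  invariant subspace to which \<open>eigenvalue_complex_mat_of\<close> applies.\<close>

lemma real_jordan_diag_pos:
  fixes A :: "real ^ 'n ^ 'n"
  assumes eig: "\<And>\<mu>. eigenvalue (complex_mat_of A) \<mu> \<Longrightarrow> Re \<mu> > 0"
    and nz: "\<And>i. i < CARD('n) \<Longrightarrow> b i \<noteq> 0"
    and D: "real_jordan_form D" "D \<in> carrier_mat CARD('n) CARD('n)"
    and rep: "\<And>j. j < CARD('n) \<Longrightarrow> A *v b j = (\<Sum>i<CARD('n). D $$ (i, j) *\<^sub>R b i)"
    and i: "i < CARD('n)"
  shows "D $$ (i, i) > 0"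
proof -
  have dim: "dim_row D = CARD('n)" using D(2) by auto
  consider "\<And>k. k < CARD('n) \<Longrightarrow> k \<noteq> i \<Longrightarrow> D $$ (k, i) = 0"
    | j where "j < CARD('n)" "j \<noteq> i" "D $$ (j, j) = D $$ (i, i)"
      "\<And>k. k < CARD('n) \<Longrightarrow> k \<noteq> i \<Longrightarrow> k \<noteq> j \<Longrightarrow> D $$ (k, i) = 0 \<and> D $$ (k, j) = 0"
    using D(1) i unfolding real_jordan_form_def dim by blast
  then show ?thesis
  proof cases
    case 1
    have "A *v b i = (\<Sum>k\<in>{i}. D $$ (k, i) *\<^sub>R b k)"
      unfolding rep[OF i] using 1 i by (intro sum.mono_neutral_right) auto
    then have "eigenvalue (complex_mat_of A) (Complex (D $$ (i, i)) 0)"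
      using nz[OF i] by (intro eigenvalue_complex_mat_of[where u = "b i" and v = 0]) auto
    from eig[OF this] show ?thesis by simp
  next
    case (2 j)
    have "D $$ (i, j) + D $$ (j, i) = 0"
      using D(1) i \<open>j < CARD('n)\<close> \<open>j \<noteq> i\<close> unfolding real_jordan_form_def dim by blast
    then have ij: "D $$ (i, j) = - D $$ (j, i)" by simp
    have "A *v b i = (\<Sum>k\<in>{i, j}. D $$ (k, i) *\<^sub>R b k)"
      unfolding rep[OF i] using 2 i by (intro sum.mono_neutral_right) auto
    then have 1: "A *v b i = D $$ (i, i) *\<^sub>R b i + D $$ (j, i) *\<^sub>R b j"
      using \<open>j \<noteq> i\<close> by simp
    have "A *v b j = (\<Sum>k\<in>{i, j}. D $$ (k, j) *\<^sub>R b k)"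
      unfolding rep[OF \<open>j < CARD('n)\<close>] using 2 i by (intro sum.mono_neutral_right) auto
    then have "A *v b j = D $$ (i, i) *\<^sub>R b j - D $$ (j, i) *\<^sub>R b i"
      using \<open>j \<noteq> i\<close> \<open>D $$ (j, j) = D $$ (i, i)\<close> ij by simp
    from eig[OF eigenvalue_complex_mat_of[OF 1 this nz[OF i]]] show ?thesis by simp
  qed
qed

text \<open>In the orthonormal basis \<open>b\<close> only the symmetric part of \<open>D\<close>
  contributes to the quadratic form, and that part is diagonal with positive entries. This is the
  source of the contraction of horizontal lengths in \<open>E_contraction\<close>.\<close>

lemma real_jordan_basis_monotone:
  fixes A :: "real ^ 'n ^ 'n" and B :: "real ^ 'n \<Rightarrow> real ^ 'n \<Rightarrow> real"
  assumes eig: "\<And>\<mu>. eigenvalue (complex_mat_of A) \<mu> \<Longrightarrow> Re \<mu> > 0"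
    and basis: "real_jordan_basis A b" and B: "bilinear B"
    and ortho: "\<And>i j. i < CARD('n) \<Longrightarrow> j < CARD('n) \<Longrightarrow> B (b i) (b j) = (if i = j then 1 else 0)"
  shows "B (A *v v) v \<ge> 0"
proof -
  let ?n = "CARD('n)"
  from basis obtain Bs where Bs: "set Bs \<subseteq> real_jordan_blocks"
    and car: "diag_block_mat Bs \<in> carrier_mat ?n ?n"
    and rep: "\<And>j. j < ?n \<Longrightarrow> A *v b j = (\<Sum>i<?n. diag_block_mat Bs $$ (i, j) *\<^sub>R b i)"
    unfolding real_jordan_basis_def by blast
  define D where "D = diag_block_mat Bs"
  have D: "real_jordan_form D"
    unfolding D_def by (rule real_jordan_form_diag_block_mat[OF Bs])
  have dim: "dim_row D = ?n" using car by (auto simp: D_def)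
  have nz: "b i \<noteq> 0" if "i < ?n" for i
    using ortho[OF that that] bilinear_lzero[OF B] by auto
  have pos: "D $$ (i, i) > 0" if "i < ?n" for i
    by (rule real_jordan_diag_pos[of A b, OF eig nz D]) (use car rep that in \<open>auto simp: D_def\<close>)
  have inj: "inj_on b {..<?n}" and "v \<in> span (b ` {..<?n})"
    using basis by (auto simp: real_jordan_basis_def)
  then obtain c where "v = (\<Sum>x\<in>b ` {..<?n}. c x *\<^sub>R x)"
    by (auto simp: span_finite)
  then have v: "v = (\<Sum>i<?n. c (b i) *\<^sub>R b i)"
    by (simp add: sum.reindex[OF inj])
  define a where "a i = c (b i)" for i
  have v: "v = (\<Sum>i<?n. a i *\<^sub>R b i)" by (simp add: v a_def)
  have linr: "linear (B x)" and linl: "linear (\<lambda>x. B x y)" for x y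
    using B by (auto simp: bilinear_def)
  have Bbv: "B (b i) v = a i" if "i < ?n" for i
  proof -
    have "B (b i) v = (\<Sum>j<?n. a j * B (b i) (b j))"
      unfolding v by (simp add: linear_sum[OF linr] linear_scale[OF linr])
    also have "\<dots> = (\<Sum>j<?n. if j = i then a j else 0)"
      by (intro sum.cong) (auto simp: ortho that)
    finally show ?thesis using that by simp
  qed
  have "A *v v = (\<Sum>j<?n. a j *\<^sub>R (\<Sum>i<?n. D $$ (i, j) *\<^sub>R b i))"
    unfolding v by (simp add: linear_sum linear_scale rep D_def matrix_vector_mult_scaleR)
  then have eq: "B (A *v v) v = (\<Sum>j<?n. \<Sum>i<?n. a j * D $$ (i, j) * a i)"
    by (simp add: linear_sum[OF linl] linear_scale[OF linl] Bbv sum_distrib_left ac_simps)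
  \<comment> \<open>Exchanging the summation indices gives a second expression with \<open>D\<close>
    transposed; adding the two symmetrizes \<open>D\<close>.\<close>
  also have "\<dots> = (\<Sum>j<?n. \<Sum>i<?n. a i * D $$ (j, i) * a j)"
    by (rule sum.swap)
  finally have "2 * B (A *v v) v = (\<Sum>j<?n. \<Sum>i<?n. a j * a i * (D $$ (i, j) + D $$ (j, i)))"
    using eq by (simp add: sum.distrib algebra_simps)
  also have "\<dots> \<ge> 0"
  proof (intro sum_nonneg)
    fix i j assume "i \<in> {..<?n}" "j \<in> {..<?n}"
    then have ij: "i < ?n" "j < ?n" by auto
    show "0 \<le> a j * a i * (D $$ (i, j) + D $$ (j, i))"
    proof (cases "i = j")
      case True
      then show ?thesis using pos[OF ij(1)] by simp
    next
      case False
      then have "D $$ (i, j) + D $$ (j, i) = 0"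
        using D ij unfolding real_jordan_form_def dim by blast
      then show ?thesis by simp
    qed
  qed
  finally show ?thesis by simp
qed

section \<open>Inner products and Gram matrices\<close>

lemma inner_product_form_Cauchy_Schwarz:
  assumes "inner_product_form B"
  shows "B v w \<le> sqrt (B v v) * sqrt (B w w)"
proof (cases "w = 0")
  case True
  moreover have "bilinear B" using assms by (simp add: inner_product_form_def)
  ultimately show ?thesis by (simp add: bilinear_rzero)
next
  case False
  have B: "bilinear B" and sym: "B w v = B v w" and pos: "B w w > 0"
    using assms False by (auto simp: inner_product_form_def)
  have "0 \<le> B u u" for u
    using assms bilinear_lzero[of B] by (cases "u = 0") (auto simp: inner_product_form_def less_imp_le)
  \<comment> \<open>The vector is \<open>B w w\<close> times the component of \<open>v\<close>
    orthogonal to \<open>w\<close>, scaled to avoid a division.\<close>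
  then have "0 \<le> B (B w w *\<^sub>R v - B v w *\<^sub>R w) (B w w *\<^sub>R v - B v w *\<^sub>R w)" .
  also have "\<dots> = B w w * (B w w * B v v - (B v w)\<^sup>2)"
    by (simp add: bilinear_lsub[OF B] bilinear_rsub[OF B] bilinear_lmul[OF B] bilinear_rmul[OF B] sym
        power2_eq_square algebra_simps)
  finally have "(B v w)\<^sup>2 \<le> B v v * B w w"
    using pos by (simp add: zero_le_mult_iff ac_simps)
  then have "\<bar>B v w\<bar> \<le> sqrt (B v v * B w w)"
    by (rule real_le_rsqrt[where x = "\<bar>B v w\<bar>", unfolded power2_abs])
  then show ?thesis by (simp add: real_sqrt_mult)
qed

text \<open>On the compact unit sphere the continuous function \<open>sqrt (B v v)\<close> attains a
  positive minimum, and homogeneity extends the bound to all vectors. It allows balls of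
  \<open>N\<close> to be enclosed in Euclidean balls.\<close>

lemma inner_product_form_norm_bound:
  fixes B :: "'a::euclidean_space \<Rightarrow> 'a \<Rightarrow> real"
  assumes "inner_product_form B"
  obtains k where "k > 0" "\<And>v. k * norm v \<le> sqrt (B v v)"
proof -
  have bil: "bilinear B" and pos: "\<And>v. v \<noteq> 0 \<Longrightarrow> B v v > 0"
    using assms by (auto simp: inner_product_form_def)
  then have bb: "bounded_bilinear B" by (simp add: bilinear_conv_bounded_bilinear)
  have cont: "continuous_on S (\<lambda>v. sqrt (B v v))" for S
    by (intro continuous_intros bounded_bilinear.continuous_on[OF bb])
  have "sphere (0 :: 'a) 1 \<noteq> {}" by simp
  then obtain u where u: "norm u = 1" "\<And>v. norm v = 1 \<Longrightarrow> sqrt (B u u) \<le> sqrt (B v v)"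
    using continuous_attains_inf[OF compact_sphere _ cont, of 0 1] by auto
  have scale: "sqrt (B v v) = norm v * sqrt (B (sgn v) (sgn v))" if "v \<noteq> 0" for v
  proof -
    have "v = norm v *\<^sub>R sgn v" using that by (simp add: sgn_div_norm)
    then have "B v v = B (norm v *\<^sub>R sgn v) (norm v *\<^sub>R sgn v)" by simp
    also have "\<dots> = (norm v)\<^sup>2 * B (sgn v) (sgn v)"
      by (simp add: bilinear_lmul[OF bil] bilinear_rmul[OF bil] power2_eq_square del: norm_scaleR)
    finally show ?thesis by (simp add: real_sqrt_mult)
  qed
  show thesis
  proof
    have "u \<noteq> 0" using u(1) by auto
    then show "sqrt (B u u) > 0" by (simp add: pos)
    show "sqrt (B u u) * norm v \<le> sqrt (B v v)" for v
    proof (cases "v = 0")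
      case False
      then show ?thesis using u(2)[of "sgn v"] scale[OF False]
        by (simp add: norm_sgn mult.commute mult_left_mono)
    qed (simp add: bilinear_lzero[OF bil])
  qed
qed

section \<open>Gram matrices and their determinants\<close>

definition gram_matrix :: "(real ^ 'm \<Rightarrow> real ^ 'm \<Rightarrow> real) \<Rightarrow> real ^ 'm ^ 'm" where
  "gram_matrix \<beta> = (\<chi> i j. \<beta> (axis i 1) (axis j 1))"

lemma gram_matrix_inner:
  assumes "bilinear \<beta>"
  shows "\<beta> v w = v \<bullet> (gram_matrix \<beta> *v w)"
proof -
  have "\<beta> v w = \<beta> (\<Sum>i\<in>UNIV. v $ i *\<^sub>R axis i 1) (\<Sum>j\<in>UNIV. w $ j *\<^sub>R axis j 1)"
    by (metis (no_types, lifting) basis_expansion scalar_mult_eq_scaleR sum.cong)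
  also have "\<dots> = (\<Sum>i\<in>UNIV. \<Sum>j\<in>UNIV. v $ i * (w $ j * \<beta> (axis i 1) (axis j 1)))"
    by (simp add: bilinear_sum[OF assms] sum.cartesian_product bilinear_lmul[OF assms]
        bilinear_rmul[OF assms] split_def ac_simps)
  finally show ?thesis
    by (simp add: gram_matrix_def inner_vec_def matrix_vector_mult_def sum_distrib_left ac_simps)
qed

lemma det_gram_matrix_pos:
  assumes "inner_product_form \<beta>"
  shows "Determinants.det (gram_matrix \<beta>) > 0"
proof (rule det_positive_definite)
  have "bilinear \<beta>" using assms by (simp add: inner_product_form_def)
  then show "v \<bullet> (gram_matrix \<beta> *v v) > 0" if "v \<noteq> 0" for v
    using assms that by (simp add: inner_product_form_def flip: gram_matrix_inner)
qed

text \<open>Pulling back by \<open>M\<close> multiplies the Gram matrix by the transpose of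
  \<open>M\<close> on the left and by \<open>M\<close> on the right.\<close>

lemma det_gram_matrix_pullback:
  assumes "bilinear \<beta>"
  shows "Determinants.det (gram_matrix (\<lambda>v w. \<beta> (M *v v) (M *v w))) =
    (Determinants.det M)\<^sup>2 * Determinants.det (gram_matrix \<beta>)"
proof -
  have "gram_matrix (\<lambda>v w. \<beta> (M *v v) (M *v w)) = Finite_Cartesian_Product.transpose M ** gram_matrix \<beta> ** M"
  proof -
    have "\<beta> (M *v v) (M *v w) = v \<bullet> ((Finite_Cartesian_Product.transpose M ** gram_matrix \<beta> ** M) *v w)" for v w
      using dot_lmul_matrix[of v "Finite_Cartesian_Product.transpose M" "gram_matrix \<beta> *v (M *v w)"]
      by (simp add: gram_matrix_inner[OF assms, of "M *v v"] matrix_vector_mul_assoc matrix_mul_assoc)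
    then show ?thesis
      by (simp add: gram_matrix_def Finite_Cartesian_Product.vec_eq_iff inner_axis' matrix_vector_mult_basis column_def)
  qed
  then show ?thesis
    by (simp add: det_mul det_transpose power2_eq_square)
qed

section \<open>Lengths and distances of continuous metrics\<close>

definition path_speed :: "'a::euclidean_space metric_form \<Rightarrow> (real \<Rightarrow> 'a) \<Rightarrow> real \<Rightarrow> real" where
  "path_speed g \<gamma> s = sqrt (g (\<gamma> s) (vector_derivative \<gamma> (at s)) (vector_derivative \<gamma> (at s)))"

lemma AE_lborel_not_in_finite:
  "finite S \<Longrightarrow> AE s in lborel. s \<notin> (S :: 'a::euclidean_space set)"
  by (intro AE_not_in) (simp add: countable_finite countable_imp_null_set_lborel)

lemma vector_derivative_join_left:
  assumes "0 < s" "s < 1/2" "(\<gamma> has_vector_derivative d) (at (2 * s))"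
  shows "vector_derivative (\<gamma> +++ \<eta>) (at s) = 2 *\<^sub>R d"
proof (rule vector_derivative_at)
  have "((\<gamma> \<circ> (\<lambda>s. 2 * s)) has_vector_derivative 2 *\<^sub>R d) (at s)"
    using assms(3) by (intro vector_diff_chain_at) (auto intro!: derivative_eq_intros
        simp flip: has_real_derivative_iff_has_vector_derivative)
  then show "(\<gamma> +++ \<eta> has_vector_derivative 2 *\<^sub>R d) (at s)"
    by (rule has_vector_derivative_transform_within_open[where S = "{..<1/2}"])
      (use assms in \<open>auto simp: joinpaths_def\<close>)
qed

lemma vector_derivative_join_right:
  assumes "1/2 < s" "s < 1" "(\<eta> has_vector_derivative d) (at (2 * s - 1))"
  shows "vector_derivative (\<gamma> +++ \<eta>) (at s) = 2 *\<^sub>R d"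
proof (rule vector_derivative_at)
  have "((\<eta> \<circ> (\<lambda>s. 2 * s - 1)) has_vector_derivative 2 *\<^sub>R d) (at s)"
    using assms(3) by (intro vector_diff_chain_at) (auto intro!: derivative_eq_intros
        simp flip: has_real_derivative_iff_has_vector_derivative)
  then show "(\<gamma> +++ \<eta> has_vector_derivative 2 *\<^sub>R d) (at s)"
    by (rule has_vector_derivative_transform_within_open[where S = "{1/2<..}"])
      (use assms in \<open>auto simp: joinpaths_def\<close>)
qed

lemma nn_integral_rescale_double:
  fixes f :: "real \<Rightarrow> real"
  assumes [measurable]: "f \<in> borel_measurable borel" and "\<And>s. f s \<ge> 0"
  shows "(\<integral>\<^sup>+ s. ennreal (2 * f (2 * s + t)) \<partial>lborel) = (\<integral>\<^sup>+ s. ennreal (f s) \<partial>lborel)"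
proof -
  have "(\<integral>\<^sup>+ s. ennreal (f s) \<partial>lborel) = 2 * (\<integral>\<^sup>+ s. ennreal (f (t + 2 * s)) \<partial>lborel)"
    by (subst nn_integral_real_affine[where c = 2 and t = t]) auto
  also have "\<dots> = (\<integral>\<^sup>+ s. 2 * ennreal (f (t + 2 * s)) \<partial>lborel)"
    by (rule nn_integral_cmult[symmetric]) measurable
  also have "\<dots> = (\<integral>\<^sup>+ s. ennreal (2 * f (2 * s + t)) \<partial>lborel)"
    using assms(2) by (intro nn_integral_cong) (simp add: ennreal_mult add.commute)
  finally show ?thesis by simp
qed

text \<open>Lengths see only the quadratic form: \<open>cont\<close> makes the speed Borel off
  finitely many points, \<open>hom\<close> governs the change of speed in a concatenation, and
  \<open>nonneg\<close> makes the speed a nonnegative function.\<close>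

locale continuous_metric =
  fixes g :: "'a::euclidean_space metric_form"
  assumes cont: "continuous_on UNIV (\<lambda>(p, v). g p v v)"
    and hom: "\<And>p v c. g p (c *\<^sub>R v) (c *\<^sub>R v) = c\<^sup>2 * g p v v"
    and nonneg: "\<And>p v. g p v v \<ge> 0"
begin

lemma path_speed_nonneg: "path_speed g \<gamma> s \<ge> 0"
  by (simp add: path_speed_def nonneg)

text \<open>Off a finite set the speed is continuous, hence Borel there, and the finite set does not
  affect the integral. The endpoints belong to \<open>S\<close> so that the junction of two
  concatenated paths is exceptional as well.\<close>

lemma path_speed_measurable:
  assumes \<gamma>: "\<gamma> piecewise_C1_differentiable_on {0..1}"
  obtains S where "finite S" "{0, 1} \<subseteq> S"
    "\<And>s. s \<in> {0..1} - S \<Longrightarrow> (\<gamma> has_vector_derivative vector_derivative \<gamma> (at s)) (at s)"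
    "(\<lambda>s. indicator ({0..1} - S) s * path_speed g \<gamma> s) \<in> borel_measurable borel"
    "riem_length g \<gamma> = (\<integral>\<^sup>+ s. ennreal (indicator ({0..1} - S) s * path_speed g \<gamma> s) \<partial>lborel)"
proof -
  obtain S0 where "finite S0" and "\<gamma> C1_differentiable_on {0..1} - S0" and c\<gamma>: "continuous_on {0..1} \<gamma>"
    using \<gamma> unfolding piecewise_C1_differentiable_on_def by blast
  define S where "S = S0 \<union> {0, 1}"
  have "\<gamma> C1_differentiable_on {0..1} - S"
    using \<open>\<gamma> C1_differentiable_on {0..1} - S0\<close> by (rule C1_differentiable_on_subset) (auto simp: S_def)
  then have diff: "\<And>s. s \<in> {0..1} - S \<Longrightarrow> \<gamma> differentiable at s"
    and c': "continuous_on ({0..1} - S) (\<lambda>s. vector_derivative \<gamma> (at s))"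
    by (auto simp: C1_differentiable_on_eq)
  have fin: "finite S" using \<open>finite S0\<close> by (simp add: S_def)
  show thesis
  proof
    show "finite S" by (rule fin)
    show "{0, 1} \<subseteq> S" by (auto simp: S_def)
    show "(\<gamma> has_vector_derivative vector_derivative \<gamma> (at s)) (at s)" if "s \<in> {0..1} - S" for s
      using diff[OF that] by (simp add: vector_derivative_works)
    have "continuous_on ({0..1} - S) (\<lambda>s. (\<gamma> s, vector_derivative \<gamma> (at s)))"
      by (intro continuous_on_Pair c' continuous_on_subset[OF c\<gamma>]) auto
    from continuous_on_compose2[OF cont this]
    have "continuous_on ({0..1} - S) (path_speed g \<gamma>)"
      unfolding path_speed_def by (auto intro: continuous_on_real_sqrt)
    moreover have "{0..1} - S \<in> sets borel"
      using fin by (intro sets.Diff) (auto intro: borel_closed finite_imp_closed)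
    ultimately show "(\<lambda>s. indicator ({0..1} - S) s * path_speed g \<gamma> s) \<in> borel_measurable borel"
      using borel_measurable_continuous_on_indicator[of "{0..1} - S" "path_speed g \<gamma>"] by simp
    show "riem_length g \<gamma> = (\<integral>\<^sup>+ s. ennreal (indicator ({0..1} - S) s * path_speed g \<gamma> s) \<partial>lborel)"
      unfolding riem_length_def path_speed_def
      by (rule nn_integral_cong_AE, rule eventually_mono[OF AE_lborel_not_in_finite[OF fin]])
        (auto simp: indicator_def)
  qed
qed

text \<open>Each path is run through in half the time at twice the speed, so each half of the
  integral rescales to the length of one path.\<close>

lemma riem_length_join:
  assumes \<gamma>: "\<gamma> piecewise_C1_differentiable_on {0..1}" and \<eta>: "\<eta> piecewise_C1_differentiable_on {0..1}"
  shows "riem_length g (\<gamma> +++ \<eta>) = riem_length g \<gamma> + riem_length g \<eta>"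
proof -
  obtain S where S: "finite S" "{0, 1} \<subseteq> S"
    "\<And>s. s \<in> {0..1} - S \<Longrightarrow> (\<gamma> has_vector_derivative vector_derivative \<gamma> (at s)) (at s)"
    and S_meas: "(\<lambda>s. indicator ({0..1} - S) s * path_speed g \<gamma> s) \<in> borel_measurable borel"
    and S_len: "riem_length g \<gamma> = (\<integral>\<^sup>+ s. ennreal (indicator ({0..1} - S) s * path_speed g \<gamma> s) \<partial>lborel)"
    using path_speed_measurable[OF \<gamma>] by blast
  obtain T where T: "finite T" "{0, 1} \<subseteq> T"
    "\<And>s. s \<in> {0..1} - T \<Longrightarrow> (\<eta> has_vector_derivative vector_derivative \<eta> (at s)) (at s)"
    and T_meas: "(\<lambda>s. indicator ({0..1} - T) s * path_speed g \<eta> s) \<in> borel_measurable borel"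
    and T_len: "riem_length g \<eta> = (\<integral>\<^sup>+ s. ennreal (indicator ({0..1} - T) s * path_speed g \<eta> s) \<partial>lborel)"
    using path_speed_measurable[OF \<eta>] by blast
  define u where "u s = indicator ({0..1} - S) s * path_speed g \<gamma> s" for s
  define v where "v s = indicator ({0..1} - T) s * path_speed g \<eta> s" for s
  have [measurable]: "u \<in> borel_measurable borel" "v \<in> borel_measurable borel"
    using S_meas T_meas by (simp_all add: u_def[abs_def] v_def[abs_def])
  have nn: "u s \<ge> 0" "v s \<ge> 0" for s
    by (simp_all add: u_def v_def path_speed_nonneg)
  \<comment> \<open>The times at which either half meets an exceptional point, that is, the
    preimages of \<open>S\<close> and \<open>T\<close> under \<open>2 * s\<close> and
    \<open>2 * s - 1\<close>.\<close>
  define X where "X = (\<lambda>s. s / 2) ` S \<union> (\<lambda>s. (s + 1) / 2) ` T"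
  have "finite X" using S(1) T(1) by (simp add: X_def)
  have key: "ennreal (path_speed g (\<gamma> +++ \<eta>) s) * indicator {0..1} s =
      ennreal (2 * u (2 * s + 0)) + ennreal (2 * v (2 * s + (-1)))" if s: "s \<notin> X" for s
  proof -
    have sS: "2 * s \<notin> S"
    proof
      assume "2 * s \<in> S"
      then have "2 * s / 2 \<in> (\<lambda>s. s / 2) ` S" by (rule imageI)
      with s show False by (simp add: X_def)
    qed
    have sT: "2 * s - 1 \<notin> T"
    proof
      assume "2 * s - 1 \<in> T"
      then have "(2 * s - 1 + 1) / 2 \<in> (\<lambda>s. (s + 1) / 2) ` T" by (rule imageI)
      with s show False by (simp add: X_def)
    qed
    consider "s < 0 \<or> s > 1" | "0 < s" "s < 1/2" | "1/2 < s" "s < 1" | "s = 0 \<or> s = 1/2 \<or> s = 1" by linarith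
    then show ?thesis
    proof cases
      case 1
      then show ?thesis by (auto simp: u_def v_def)
    next
      case 2
      have "vector_derivative (\<gamma> +++ \<eta>) (at s) = 2 *\<^sub>R vector_derivative \<gamma> (at (2 * s))"
        using 2 sS by (intro vector_derivative_join_left S(3)) auto
      then have "path_speed g (\<gamma> +++ \<eta>) s = 2 * path_speed g \<gamma> (2 * s)"
        using 2 by (simp add: path_speed_def hom real_sqrt_mult) (simp add: joinpaths_def)
      then show ?thesis using 2 sS by (simp add: u_def v_def)
    next
      case 3
      have "vector_derivative (\<gamma> +++ \<eta>) (at s) = 2 *\<^sub>R vector_derivative \<eta> (at (2 * s - 1))"
        using 3 sT by (intro vector_derivative_join_right T(3)) auto
      then have "path_speed g (\<gamma> +++ \<eta>) s = 2 * path_speed g \<eta> (2 * s - 1)"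
        using 3 by (simp add: path_speed_def hom real_sqrt_mult) (simp add: joinpaths_def)
      then show ?thesis using 3 sT by (simp add: u_def v_def)
    next
      \<comment> \<open>Ends and junction lie in \<open>X\<close>, because \<open>S\<close> and
        \<open>T\<close> contain \<open>0\<close> and \<open>1\<close>.\<close>
      case 4
      then have "2 * s = 0 \<or> 2 * s = 1 \<or> 2 * s - 1 = 1" by auto
      then have False using sS sT S(2) T(2) by fastforce
      then show ?thesis ..
    qed
  qed
  have "riem_length g (\<gamma> +++ \<eta>) =
      (\<integral>\<^sup>+ s. ennreal (2 * u (2 * s + 0)) + ennreal (2 * v (2 * s + (-1))) \<partial>lborel)"
    unfolding riem_length_def path_speed_def[symmetric]
    by (rule nn_integral_cong_AE, rule eventually_mono[OF AE_lborel_not_in_finite[OF \<open>finite X\<close>]])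
      (rule key)
  also have "\<dots> = (\<integral>\<^sup>+ s. ennreal (2 * u (2 * s + 0)) \<partial>lborel) +
      (\<integral>\<^sup>+ s. ennreal (2 * v (2 * s + (-1))) \<partial>lborel)"
    by (rule nn_integral_add) measurable
  also have "\<dots> = riem_length g \<gamma> + riem_length g \<eta>"
    unfolding S_len T_len u_def[symmetric] v_def[symmetric]
    by (intro arg_cong2[of _ _ _ _ "(+)"] nn_integral_rescale_double nn) measurable
  finally show ?thesis .
qed

lemma riem_dist_le_length:
  assumes "\<gamma> piecewise_C1_differentiable_on {0..1}" "pathstart \<gamma> = x" "pathfinish \<gamma> = y"
  shows "riem_dist g x y \<le> riem_length g \<gamma>"
  unfolding riem_dist_def using assms by (intro Inf_lower) auto

lemma riem_dist_lessE:
  assumes "riem_dist g x y < c"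
  obtains \<gamma> where "\<gamma> piecewise_C1_differentiable_on {0..1}" "pathstart \<gamma> = x" "pathfinish \<gamma> = y"
    "riem_length g \<gamma> < c"
  using assms unfolding riem_dist_def Inf_less_iff by blast

text \<open>Strict bounds provide two actual paths to concatenate, so no approximation of the
  infimum is needed.\<close>

lemma riem_dist_triangle_less:
  assumes "riem_dist g x y < a" "riem_dist g y z < b"
  shows "riem_dist g x z < a + b"
proof -
  obtain \<gamma> where \<gamma>: "\<gamma> piecewise_C1_differentiable_on {0..1}" "pathstart \<gamma> = x" "pathfinish \<gamma> = y"
    "riem_length g \<gamma> < a" using assms(1) by (rule riem_dist_lessE)
  obtain \<eta> where \<eta>: "\<eta> piecewise_C1_differentiable_on {0..1}" "pathstart \<eta> = y" "pathfinish \<eta> = z"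
    "riem_length g \<eta> < b" using assms(2) by (rule riem_dist_lessE)
  have "(\<gamma> +++ \<eta>) piecewise_C1_differentiable_on {0..1}"
    using valid_path_join[of \<gamma> \<eta>] \<gamma> \<eta> by (simp add: valid_path_def)
  then have "riem_dist g x z \<le> riem_length g (\<gamma> +++ \<eta>)"
    using \<gamma> \<eta> by (intro riem_dist_le_length) auto
  also have "\<dots> = riem_length g \<gamma> + riem_length g \<eta>"
    by (rule riem_length_join[OF \<gamma>(1) \<eta>(1)])
  also have "\<dots> < a + b"
    using \<gamma>(4) \<eta>(4) by (rule add_strict_mono)
  finally show ?thesis .
qed

lemma riem_dist_linepath:
  assumes "\<And>s. s \<in> {0..1} \<Longrightarrow> sqrt (g (linepath x y s) (y - x) (y - x)) = L"
  shows "riem_dist g x y \<le> ennreal L"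
proof -
  have "riem_length g (linepath x y) = (\<integral>\<^sup>+ s. ennreal L * indicator {0..1::real} s \<partial>lborel)"
    unfolding riem_length_def using assms
    by (intro nn_integral_cong) (auto simp: vector_derivative_linepath_at indicator_def)
  also have "\<dots> = ennreal L"
    by (simp add: nn_integral_cmult_indicator)
  finally show ?thesis
    using riem_dist_le_length[of "linepath x y" x y] valid_path_linepath[of x y]
    by (simp add: valid_path_def)
qed

text \<open>A piecewise \<open>C\<^sup>1\<close> path may have unbounded derivative near its exceptional points. The gauge
  integral still satisfies the fundamental theorem there, and only the speed need be integrable.\<close>

lemma linear_along_path_le:
  assumes \<gamma>: "\<gamma> piecewise_C1_differentiable_on {0..1}" and len: "riem_length g \<gamma> < ennreal r"
  obtains \<sigma> I where "I < r" "(\<sigma> has_integral I) {0..1}"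
    "\<forall>l a b. bounded_linear l \<and> 0 \<le> a \<and> a \<le> b \<and> b \<le> 1 \<and>
      (\<forall>s\<in>{a..b}. \<forall>v. l v \<le> sqrt (g (\<gamma> s) v v)) \<longrightarrow> l (\<gamma> b) - l (\<gamma> a) \<le> integral {a..b} \<sigma>"
proof -
  obtain S where S: "finite S" "{0, 1} \<subseteq> S"
    "\<And>s. s \<in> {0..1} - S \<Longrightarrow> (\<gamma> has_vector_derivative vector_derivative \<gamma> (at s)) (at s)"
    and S_meas: "(\<lambda>s. indicator ({0..1} - S) s * path_speed g \<gamma> s) \<in> borel_measurable borel"
    and S_len: "riem_length g \<gamma> = (\<integral>\<^sup>+ s. ennreal (indicator ({0..1} - S) s * path_speed g \<gamma> s) \<partial>lborel)"
    using path_speed_measurable[OF \<gamma>] by blast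
  define \<sigma> where "\<sigma> s = indicator ({0..1} - S) s * path_speed g \<gamma> s" for s
  have nn: "\<sigma> s \<ge> 0" for s by (simp add: \<sigma>_def path_speed_nonneg)
  have "(\<integral>\<^sup>+ s. ennreal (\<sigma> s) \<partial>lborel) < ennreal r"
    using len by (simp add: S_len \<sigma>_def)
  then obtain I where I: "(\<integral>\<^sup>+ s. ennreal (\<sigma> s) \<partial>lborel) = ennreal I" "0 \<le> I" "I < r"
    by (cases "\<integral>\<^sup>+ s. ennreal (\<sigma> s) \<partial>lborel") (auto simp: ennreal_less_iff)
  have "(\<sigma> has_integral I) UNIV"
    by (rule nn_integral_has_integral) (use S_meas nn I in \<open>auto simp: \<sigma>_def[abs_def]\<close>)
  \<comment> \<open>As \<open>\<sigma>\<close> vanishes outside the unit interval, its integral over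
    the line is its integral over \<open>{0..1}\<close>.\<close>
  moreover have "(\<lambda>s. if s \<in> {0..1} then \<sigma> s else 0) = \<sigma>"
    by (auto simp: \<sigma>_def fun_eq_iff)
  ultimately have int: "(\<sigma> has_integral I) {0..1}"
    using has_integral_restrict_UNIV[of "{0..1}" \<sigma> I] by simp
  have bound: "l (\<gamma> b) - l (\<gamma> a) \<le> integral {a..b} \<sigma>"
    if l: "bounded_linear l" and ab: "0 \<le> a" "a \<le> b" "b \<le> 1"
      and le: "\<And>s v. s \<in> {a..b} \<Longrightarrow> l v \<le> sqrt (g (\<gamma> s) v v)" for l a b
  proof -
    have "continuous_on {0..1} \<gamma>"
      using \<gamma> by (simp add: piecewise_C1_differentiable_on_def)
    then have "continuous_on {a..b} (\<lambda>s. l (\<gamma> s))"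
      using ab by (intro bounded_linear.continuous_on[OF l]) (auto elim: continuous_on_subset)
    \<comment> \<open>Both \<open>D\<close> and \<open>\<sigma>\<close> are \<open>0\<close> on
      \<open>S\<close>, so that the comparison \<open>D s \<le> \<sigma> s\<close> holds at every
      point.\<close>
    moreover define D where "D s = (if s \<in> S then 0 else l (vector_derivative \<gamma> (at s)))" for s
    ultimately have "(D has_integral l (\<gamma> b) - l (\<gamma> a)) {a..b}"
      using ab S(3)
      by (intro fundamental_theorem_of_calculus_interior_strong[OF S(1)])
        (auto intro!: bounded_linear.has_vector_derivative[OF l])
    moreover have "\<sigma> integrable_on {a..b}"
      using int ab by (auto intro: integrable_subinterval_real)
    moreover have "D s \<le> \<sigma> s" if "s \<in> {a..b}" for s
      using le[OF that] that ab by (auto simp: D_def \<sigma>_def path_speed_def)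
    ultimately show ?thesis
      by (intro has_integral_le[OF _ integrable_integral])
  qed
  show thesis
    using that[OF I(3) int] bound by blast
qed

end

section \<open>The group \<open>G(A)\<close>\<close>

text \<open>The Gram matrix in \<open>riem_volume\<close> is indexed by \<open>'n option\<close>.
  This isomorphism matches the coordinate frame with the standard axes, so that results on square
  matrices apply to forms on the product.\<close>

definition vec_of_prod:: "(real ^ 'n) \<times> real \<Rightarrow> real ^ ('n option)" where
  "vec_of_prod p = (\<chi> i. case i of None \<Rightarrow> snd p | Some k \<Rightarrow> fst p $ k)"

definition prod_of_vec :: "real ^ ('n option) \<Rightarrow> (real ^ 'n) \<times> real" where
  "prod_of_vec v = (\<chi> k. v $ Some k, v $ None)"

lemma vec_of_prod_inverse [simp]: "prod_of_vec (vec_of_prod p) = p"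
  by (simp add: prod_of_vec_def vec_of_prod_def prod_eq_iff Finite_Cartesian_Product.vec_eq_iff)

lemma prod_of_vec_inverse [simp]: "vec_of_prod (prod_of_vec v) = v"
  by (simp add: prod_of_vec_def vec_of_prod_def Finite_Cartesian_Product.vec_eq_iff split: option.split)

lemma linear_vec_of_prod: "linear vec_of_prod"
  by (rule linearI) (simp_all add: vec_of_prod_def Finite_Cartesian_Product.vec_eq_iff split: option.split)

lemma linear_prod_of_vec: "linear prod_of_vec"
  by (rule linearI) (simp_all add: prod_of_vec_def prod_eq_iff Finite_Cartesian_Product.vec_eq_iff)

lemma prod_of_vec_axis: "prod_of_vec (axis k 1) = coord_frame k"
  by (simp add: prod_of_vec_def coord_frame_def axis_def prod_eq_iff Finite_Cartesian_Product.vec_eq_iff split: option.split)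

text \<open>The differential of a left translation of \<open>G(A)\<close> by an element of height \<open>t\<close>, as a matrix
  in the coordinate frame.\<close>

definition translation_matrix :: "real ^ 'n ^ 'n \<Rightarrow> real \<Rightarrow> real ^ ('n option) ^ ('n option)" where
  "translation_matrix A t =
     matrix (\<lambda>v. vec_of_prod (matrix_exp (t *\<^sub>R A) *v fst (prod_of_vec v), snd (prod_of_vec v)))"

lemma translation_matrix_vector:
  "translation_matrix A t *v v =
    vec_of_prod (matrix_exp (t *\<^sub>R A) *v fst (prod_of_vec v), snd (prod_of_vec v))"
proof -
  have "linear (\<lambda>v. vec_of_prod (matrix_exp (t *\<^sub>R A) *v fst (prod_of_vec v), snd (prod_of_vec v)))"
    by (intro linear_compose[OF _ linear_vec_of_prod, unfolded o_def] linearI)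
      (simp_all add: linear_add[OF linear_prod_of_vec] linear_scale[OF linear_prod_of_vec] matrix_vector_right_distrib matrix_vector_mult_scaleR)
  then show ?thesis
    unfolding translation_matrix_def by (simp add: matrix_works)
qed

text \<open>These matrices form a one-parameter group whose generator is \<open>A\<close> bordered
  by a zero row and column, which has the same trace as \<open>A\<close>.\<close>

lemma det_translation_matrix:
  "Determinants.det (translation_matrix A t) = exp (t * trace A)"
proof -
  let ?M = "translation_matrix A"
  define D where "D = matrix (\<lambda>v. vec_of_prod (A *v fst (prod_of_vec v), 0))"
  have add: "?M (s + t) = ?M s ** ?M t" for s t
    by (subst matrix_eq) (simp add: translation_matrix_vector matrix_exp_add
        matrix_vector_mul_assoc[symmetric])
  have zero: "?M 0 = id_mat"
    by (subst matrix_eq) (simp add: translation_matrix_vector)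
  have "((\<lambda>t. ?M t $ i $ j) has_real_derivative D $ i $ j) (at 0)" for i j
  proof (cases i)
    case None
    then show ?thesis
      by (simp add: translation_matrix_def D_def matrix_def vec_of_prod_def)
  next
    case (Some k)
    have "((\<lambda>t. (matrix_exp (t *\<^sub>R A) *v w) $ k) has_real_derivative (A *v w) $ k) (at 0)" for w
      using bounded_linear.has_vector_derivative[OF bounded_linear_vec_nth
          bounded_linear.has_vector_derivative[OF bounded_bilinear.bounded_linear_left
            [OF bounded_bilinear_matrix_vector_mult] matrix_exp_has_vector_derivative[of A 0]]]
      by (simp add: has_real_derivative_iff_has_vector_derivative)
    then show ?thesis
      by (simp add: Some translation_matrix_def D_def matrix_def vec_of_prod_def)
  qed
  then have "(?M has_vector_derivative D) (at 0)"
    by (rule has_vector_derivative_matrixI)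
  with add zero have "Determinants.det (?M t) = exp (t * trace D)"
    by (intro det_one_parameter_group)
  also have "trace D = trace A"
    by (simp add: trace_def UNIV_option_conv sum.reindex D_def matrix_def vec_of_prod_def
        prod_of_vec_axis coord_frame_def matrix_vector_mult_basis column_def)
  finally show ?thesis .
qed

text \<open>The spectrum and the Jordan basis act on volume growth through \<open>monotone\<close>
  and \<open>trace_nonneg\<close>; the other assumptions describe the metric.\<close>

locale heintze_group =
  fixes A :: "real ^ 'n ^ 'n" and g :: "((real ^ 'n) \<times> real) metric_form"
  assumes invariant: "left_invariant A g"
    and inner_form: "inner_product_form (g 0)"
    and unit: "g 0 (0, 1) (0, 1) = 1"
    and orthogonal: "\<And>v. g 0 (v, 0) (0, 1) = 0"
    and monotone: "\<And>v. g 0 (A *v v, 0) (v, 0) \<ge> 0"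
    and trace_nonneg: "trace A \<ge> 0"
begin

section \<open>The flow \<open>E\<close>, the inner product \<open>B\<close> and the metric in
  coordinates\<close>

definition E :: "real \<Rightarrow> real ^ 'n ^ 'n" where "E t = matrix_exp (t *\<^sub>R A)"

definition B :: "real ^ 'n \<Rightarrow> real ^ 'n \<Rightarrow> real" where "B v w = g 0 (v, 0) (w, 0)"

definition N :: "real ^ 'n \<Rightarrow> real" where "N v = sqrt (B v v)"

lemma E_zero [simp]: "E 0 = id_mat"
  by (simp add: E_def)

lemma E_add: "E (s + t) *v v = E s *v (E t *v v)"
  by (simp add: E_def matrix_exp_add matrix_vector_mul_assoc)

lemma E_inverse [simp]: "E t *v (E (- t) *v v) = v" "E (- t) *v (E t *v v) = v"
  using E_add[of t "- t" v] E_add[of "- t" t v] by simp_all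

lemma det_E: "Determinants.det (E t) = exp (t * trace A)"
  by (simp add: E_def det_matrix_exp)

lemma E_has_vector_derivative: "(E has_vector_derivative A ** E t) (at t)"
  unfolding E_def[abs_def] by (rule matrix_exp_has_vector_derivative)

lemma continuous_on_E: "continuous_on S E"
  using E_has_vector_derivative has_vector_derivative_continuous
  by (blast intro: continuous_at_imp_continuous_on)

lemma B_inner_product_form: "inner_product_form B"
proof -
  have bil: "bilinear (g 0)" using inner_form by (simp add: inner_product_form_def)
  have lin: "linear (\<lambda>v :: real ^ 'n. (v, 0 :: real))"
    by (rule linearI) simp_all
  have "bilinear B"
    unfolding B_def bilinear_def using bil lin
    by (auto simp: bilinear_def intro: linear_compose[OF lin, unfolded o_def])
  moreover have "B v w = B w v" for v w
    using inner_form by (simp add: B_def inner_product_form_def)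
  moreover have "B v v > 0" if "v \<noteq> 0" for v
    using inner_form that by (simp add: B_def inner_product_form_def zero_prod_def)
  ultimately show ?thesis by (simp add: inner_product_form_def)
qed

lemma B_bilinear: "bilinear B"
  using B_inner_product_form by (simp add: inner_product_form_def)

lemma B_nonneg: "B v v \<ge> 0"
  using B_inner_product_form bilinear_lzero[OF B_bilinear]
  by (cases "v = 0") (auto simp: inner_product_form_def less_imp_le)

lemma continuous_on_B [continuous_intros]:
  assumes "continuous_on S f" "continuous_on S h"
  shows "continuous_on S (\<lambda>x. B (f x) (h x))"
  using bounded_bilinear.continuous_on[OF _ assms] B_bilinear
  by (auto simp: bilinear_conv_bounded_bilinear)

lemma continuous_on_matrix_vector_mult [continuous_intros]:
  assumes "continuous_on S (f :: _ \<Rightarrow> real ^ 'n ^ 'n)" "continuous_on S h"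
  shows "continuous_on S (\<lambda>x. f x *v h x)"
  by (rule bounded_bilinear.continuous_on[OF bounded_bilinear_matrix_vector_mult assms])

lemma continuous_on_E_compose [continuous_intros]:
  assumes "continuous_on S f"
  shows "continuous_on S (\<lambda>x. E (f x))"
  by (rule continuous_on_compose2[OF continuous_on_E[of UNIV] assms]) auto

lemma metric_identity: "g 0 (v, a) (w, b) = B v w + a * b"
proof -
  have bil: "bilinear (g 0)" and sym: "g 0 (0, 1) (w, 0) = g 0 (w, 0) (0, 1)"
    using inner_form by (auto simp: inner_product_form_def)
  have "(v, a) = (v, 0) + a *\<^sub>R (0, 1)" "(w, b) = (w, 0) + b *\<^sub>R (0, 1)"
    by simp_all
  then have "g 0 (v, a) (w, b) = g 0 ((v, 0) + a *\<^sub>R (0, 1)) ((w, 0) + b *\<^sub>R (0, 1))"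
    by simp
  also have "\<dots> = B v w + a * b"
    unfolding bilinear_ladd[OF bil] bilinear_radd[OF bil] bilinear_lmul[OF bil] bilinear_rmul[OF bil]
    by (simp add: orthogonal sym unit B_def)
  finally show ?thesis .
qed

text \<open>Left translation by \<open>(x, t)\<close> is affine and carries \<open>0\<close> to
  \<open>(x, t)\<close>; its differential acts by \<open>E t\<close> on the horizontal part and
  fixes the vertical one, so invariance moves the computation to \<open>g 0\<close>.\<close>

lemma metric_eq: "g (x, t) (v, a) (w, b) = B (E (- t) *v v) (E (- t) *v w) + a * b"
proof -
  have deriv: "frechet_derivative (heintze_mult A (x, t)) (at 0) = (\<lambda>q. (E t *v fst q, snd q))"
  proof (rule frechet_derivative_at[symmetric])
    have "((\<lambda>q. (x + E t *v fst q, t + snd q)) has_derivative (\<lambda>q. (E t *v fst q, snd q))) (at 0)"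
      by (auto intro!: derivative_eq_intros
          bounded_linear.has_derivative[OF bounded_bilinear.bounded_linear_right
            [OF bounded_bilinear_matrix_vector_mult]])
    then show "(heintze_mult A (x, t) has_derivative (\<lambda>q. (E t *v fst q, snd q))) (at 0)"
      by (simp add: heintze_mult_def[abs_def] E_def)
  qed
  have base: "heintze_mult A (x, t) 0 = (x, t)"
    by (simp add: heintze_mult_def)
  \<comment> \<open>The tangent vectors at \<open>0\<close> are the preimages of
    \<open>(v, a)\<close> and \<open>(w, b)\<close> under the differential.\<close>
  have "g (heintze_mult A (x, t) 0)
      (frechet_derivative (heintze_mult A (x, t)) (at 0) (E (- t) *v v, a))
      (frechet_derivative (heintze_mult A (x, t)) (at 0) (E (- t) *v w, b)) =
      g 0 (E (- t) *v v, a) (E (- t) *v w, b)"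
    using invariant unfolding left_invariant_def by blast
  then show ?thesis
    by (simp add: deriv base metric_identity)
qed

text \<open>The squared norm has derivative \<open>- 2 * B (A *v z) z\<close> along the curve
  \<open>z = E (- t) *v v\<close>, which is nonpositive by \<open>monotone\<close>.\<close>

lemma E_contraction:
  assumes "t \<ge> 0"
  shows "N (E (- t) *v v) \<le> N v"
proof -
  define q where "q t = B (E (- t) *v v) (E (- t) *v v)" for t
  have d: "(q has_real_derivative - 2 * B (A *v (E (- t) *v v)) (E (- t) *v v)) (at t)" for t
  proof -
    have "((\<lambda>t. E (- t)) has_vector_derivative - (A ** E (- t))) (at t)"
      using vector_diff_chain_at[OF has_vector_derivative_minus[OF has_vector_derivative_id]
          E_has_vector_derivative, of t] by (simp add: o_def)
    then have "((\<lambda>t. E (- t) *v v) has_vector_derivative - (A ** E (- t)) *v v) (at t)"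
      by (rule bounded_linear.has_vector_derivative[OF bounded_bilinear.bounded_linear_left
            [OF bounded_bilinear_matrix_vector_mult]])
    moreover have "- (A ** E (- t)) *v v = - (A *v (E (- t) *v v))"
      by (simp add: bounded_bilinear.minus_left[OF bounded_bilinear_matrix_vector_mult] matrix_vector_mul_assoc)
    ultimately have e: "((\<lambda>t. E (- t) *v v) has_vector_derivative - (A *v (E (- t) *v v))) (at t)"
      by simp
    have sym: "B v w = B w v" for v w
      using B_inner_product_form by (simp add: inner_product_form_def)
    show ?thesis
      unfolding q_def[abs_def] has_real_derivative_iff_has_vector_derivative
      using bounded_bilinear.has_vector_derivative[OF B_bilinear[unfolded bilinear_conv_bounded_bilinear] e e]
      by (simp add: bilinear_lneg[OF B_bilinear] bilinear_rneg[OF B_bilinear]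
          sym[of "E (- t) *v v" "A *v (E (- t) *v v)"])
  qed
  have "q t \<le> q 0"
    by (rule DERIV_nonpos_imp_nonincreasing[OF assms], rule exI, rule conjI, rule d)
      (use monotone in \<open>simp add: B_def\<close>)
  then show ?thesis by (simp add: q_def N_def)
qed

lemma N_mono: "t \<le> T \<Longrightarrow> N (E (- T) *v v) \<le> N (E (- t) *v v)"
  using E_contraction[of "T - t" "E (- t) *v v"] E_add[of "t - T" "- t" v] by simp

sublocale continuous_metric g
proof
  have "(\<lambda>(p, v). g p v v) = (\<lambda>z. B (E (- snd (fst z)) *v fst (snd z)) (E (- snd (fst z)) *v fst (snd z))
      + snd (snd z) * snd (snd z))"
    by (auto simp: fun_eq_iff metric_eq)
  moreover have "continuous_on UNIV \<dots>"
    by (intro continuous_intros)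
  ultimately show "continuous_on UNIV (\<lambda>(p, v). g p v v)" by simp
  show "g p (c *\<^sub>R v) (c *\<^sub>R v) = c\<^sup>2 * g p v v" for p v c
    by (cases p; cases v) (simp add: metric_eq bilinear_lmul[OF B_bilinear] bilinear_rmul[OF B_bilinear]
        matrix_vector_mult_scaleR power2_eq_square algebra_simps)
  show "g p v v \<ge> 0" for p v
    by (cases p; cases v) (simp add: metric_eq B_nonneg)
qed

text \<open>The metric at height \<open>t\<close> is the pullback of \<open>g 0\<close> by the
  translation matrix of height \<open>- t\<close>, so its Gram determinant changes by the square of
  \<open>exp (- (t * trace A))\<close>. The constant comes from the Gram matrix of
  \<open>g 0\<close>.\<close>

lemma volume_density:
  obtains c where "c > 0"
    "\<And>x t. sqrt (Determinants.det (\<chi> i j. g (x, t) (coord_frame i) (coord_frame j) :: real ^ ('n option) ^ ('n option)))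
       = c * exp (- (t * trace A))"
proof -
  define \<beta> where "\<beta> v w = g 0 (prod_of_vec v) (prod_of_vec w)" for v w
  have "bilinear \<beta>"
  proof -
    have "linear (g 0 p)" "linear (\<lambda>q. g 0 q p)" for p
      using inner_form unfolding inner_product_form_def bilinear_def by blast+
    from this[THEN linear_compose[OF linear_prod_of_vec]] show ?thesis
      by (simp add: \<beta>_def bilinear_def o_def)
  qed
  moreover have "prod_of_vec v \<noteq> 0" if "v \<noteq> 0" for v :: "real ^ ('n option)"
    using that linear_0[OF linear_vec_of_prod] by (metis prod_of_vec_inverse)
  ultimately have \<beta>: "inner_product_form \<beta>"
    using inner_form by (simp only: inner_product_form_def \<beta>_def) blast
  define c where "c = sqrt (Determinants.det (gram_matrix \<beta>))"
  have "c > 0" using det_gram_matrix_pos[OF \<beta>] by (simp add: c_def)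
  moreover have "sqrt (Determinants.det (\<chi> i j. g (x, t) (coord_frame i) (coord_frame j) :: real ^ ('n option) ^ ('n option)))
       = c * exp (- (t * trace A))" for x t
  proof -
    have "g (x, t) (coord_frame i) (coord_frame j) =
        \<beta> (translation_matrix A (- t) *v axis i 1) (translation_matrix A (- t) *v axis j 1)" for i j
      by (simp add: translation_matrix_vector prod_of_vec_axis \<beta>_def metric_identity
          metric_eq[of x t "fst (coord_frame i)" "snd (coord_frame i)" "fst (coord_frame j)" "snd (coord_frame j)", simplified]
          E_def)
    then have "(\<chi> i j. g (x, t) (coord_frame i) (coord_frame j) :: real ^ ('n option) ^ ('n option)) =
        gram_matrix (\<lambda>v w. \<beta> (translation_matrix A (- t) *v v) (translation_matrix A (- t) *v w))"
      by (simp add: gram_matrix_def)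
    then show ?thesis
      using \<open>bilinear \<beta>\<close>
      by (simp add: det_gram_matrix_pullback det_translation_matrix real_sqrt_mult c_def)
  qed
  ultimately show thesis by (rule that)
qed

section \<open>Distances and balls of the group\<close>

lemma N_nonneg: "N v \<ge> 0"
  by (simp add: N_def B_nonneg)

lemma riem_dist_horizontal: "riem_dist g (x, t) (y, t) \<le> ennreal (N (E (- t) *v (y - x)))"
proof (rule riem_dist_linepath)
  fix s :: real
  have "linepath (x, t) (y, t) s = (linepath x y s, t)"
    by (simp add: linepath_def algebra_simps)
  then show "sqrt (g (linepath (x, t) (y, t) s) ((y, t) - (x, t)) ((y, t) - (x, t))) = N (E (- t) *v (y - x))"
    by (simp add: metric_eq N_def)
qed

lemma riem_dist_vertical: "riem_dist g (x, t) (x, u) \<le> ennreal \<bar>u - t\<bar>"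
proof (rule riem_dist_linepath)
  fix s :: real
  have "linepath (x, t) (x, u) s = (x, linepath t u s)"
    by (simp add: linepath_def algebra_simps)
  then show "sqrt (g (linepath (x, t) (x, u) s) ((x, u) - (x, t)) ((x, u) - (x, t))) = \<bar>u - t\<bar>"
    by (simp add: metric_eq bilinear_lzero[OF B_bilinear])
qed

text \<open>The horizontal move is made first, at the starting height \<open>t\<close>, where its
  cost does not depend on \<open>u\<close>; the vertical move follows.\<close>

lemma riem_dist_less:
  assumes "N (E (- t) *v (y - x)) < a" "\<bar>u - t\<bar> < b"
  shows "riem_dist g (x, t) (y, u) < ennreal (a + b)"
proof -
  have ab: "0 < a" "0 < b" using assms N_nonneg[of "E (- t) *v (y - x)"] by linarith+
  have "riem_dist g (x, t) (y, t) < ennreal a"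
    by (rule le_less_trans[OF riem_dist_horizontal]) (simp add: ennreal_lessI ab assms)
  moreover have "riem_dist g (y, t) (y, u) < ennreal b"
    by (rule le_less_trans[OF riem_dist_vertical]) (simp add: ennreal_lessI ab assms)
  ultimately show ?thesis
    using riem_dist_triangle_less ab by (fastforce simp: ennreal_plus)
qed

lemma open_N_ball: "open {q. N (E (- t) *v (fst q - x)) < a \<and> \<bar>snd q - t\<bar> < b}"
  unfolding N_def
  by (intro open_Collect_conj open_Collect_less continuous_intros)

text \<open>Openness supplies the measurability of the ball that monotonicity of the volume requires
  in \<open>volume_lower_bound\<close>.\<close>

lemma open_riem_ball: "open (riem_ball g p r)"
proof (subst open_subopen, rule ballI)
  fix q assume "q \<in> riem_ball g p r"
  then have "riem_dist g p q < ennreal r" by (simp add: riem_ball_def)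
  then obtain c where c: "riem_dist g p q < c" "c < ennreal r" using dense by blast
  from c(2) obtain d where d: "c = ennreal d" "0 \<le> d" "d < r"
    by (cases c) (auto simp: ennreal_less_iff)
  \<comment> \<open>Half of the slack \<open>r - d\<close> pays for the horizontal move and half for
    the vertical one.\<close>
  define e where "e = (r - d) / 2"
  have e: "e > 0" using d by (simp add: e_def)
  obtain x t where q: "q = (x, t)" by fastforce
  let ?U = "{q'. N (E (- t) *v (fst q' - x)) < e \<and> \<bar>snd q' - t\<bar> < e}"
  have "q \<in> ?U"
    using e by (simp add: q N_def bilinear_lzero[OF B_bilinear])
  moreover have "?U \<subseteq> riem_ball g p r"
  proof
    fix q' assume "q' \<in> ?U"
    then have "riem_dist g q q' < ennreal (e + e)"
      using riem_dist_less[of t "fst q'" x e "snd q'" e] by (simp add: q)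
    from riem_dist_triangle_less[OF c(1) this]
    show "q' \<in> riem_ball g p r"
      using d e by (simp add: riem_ball_def e_def flip: ennreal_plus)
  qed
  ultimately show "\<exists>T. open T \<and> q \<in> T \<and> T \<subseteq> riem_ball g p r"
    by (intro exI[of _ ?U] conjI open_N_ball)
qed

text \<open>Climbing from \<open>t\<close> to a height and coming down to \<open>u\<close> costs at
  least twice that height minus \<open>t + u\<close>, which bounds the height by \<open>T\<close>.
  Below \<open>T\<close> the speed dominates \<open>N (E (- T) *v v)\<close> for the horizontal part
  \<open>v\<close> of the velocity, so the displacement can be measured with the fixed norm at
  height \<open>T\<close>.\<close>

lemma riem_dist_estimate:
  assumes dist: "riem_dist g (x, t) (y, u) < ennreal r"
  shows "\<bar>u - t\<bar> \<le> r" "N (E (- ((r + t + u) / 2)) *v (y - x)) \<le> r"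
proof -
  define T where "T = (r + t + u) / 2"
  obtain \<gamma> where \<gamma>: "\<gamma> piecewise_C1_differentiable_on {0..1}" "pathstart \<gamma> = (x, t)" "pathfinish \<gamma> = (y, u)"
    and len: "riem_length g \<gamma> < ennreal r"
    by (rule riem_dist_lessE[OF dist])
  have \<gamma>01: "\<gamma> 0 = (x, t)" "\<gamma> 1 = (y, u)"
    using \<gamma> by (simp_all add: pathstart_def pathfinish_def)
  obtain \<sigma> I where I: "I < r" "(\<sigma> has_integral I) {0..1}"
    and bound: "\<forall>l a b. bounded_linear l \<and> 0 \<le> a \<and> a \<le> b \<and> b \<le> 1 \<and>
      (\<forall>s\<in>{a..b}. \<forall>v. l v \<le> sqrt (g (\<gamma> s) v v)) \<longrightarrow> l (\<gamma> b) - l (\<gamma> a) \<le> integral {a..b} \<sigma>"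
    by (rule linear_along_path_le[OF \<gamma>(1) len])
  have speed: "sqrt (g p v v) = sqrt ((N (E (- snd p) *v fst v))\<^sup>2 + (snd v)\<^sup>2)" for p v
    by (cases p; cases v) (simp add: metric_eq N_def B_nonneg power2_eq_square)
  have height: "\<bar>snd v\<bar> \<le> sqrt (g p v v)" and width: "N (E (- snd p) *v fst v) \<le> sqrt (g p v v)" for p v
    unfolding speed by (auto intro: real_le_rsqrt)
  have bound_T: "snd (\<gamma> s) \<le> T" if s: "s \<in> {0..1}" for s
  proof -
    have "snd (\<gamma> s) - snd (\<gamma> 0) \<le> integral {0..s} \<sigma>"
      using s by (intro bound[rule_format] conjI ballI allI bounded_linear_snd)
        (auto intro: order_trans[OF abs_ge_self height])
    moreover have "- snd (\<gamma> 1) - (- snd (\<gamma> s)) \<le> integral {s..1} \<sigma>"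
      using s by (intro bound[rule_format, of "\<lambda>p. - snd p"] conjI ballI allI bounded_linear_minus bounded_linear_snd)
        (auto intro: order_trans[OF abs_ge_minus_self height])
    moreover have "integral {0..s} \<sigma> + integral {s..1} \<sigma> = I"
      using s I(2) by (subst Henstock_Kurzweil_Integration.integral_combine) auto
    ultimately show ?thesis using I(1) by (simp add: \<gamma>01 T_def)
  qed
  \<comment> \<open>At the two ends the height bound reads \<open>t \<le> T\<close> and
    \<open>u \<le> T\<close>, which is equivalent to this inequality.\<close>
  from bound_T[of 0] bound_T[of 1] show "\<bar>u - t\<bar> \<le> r"
    by (simp add: \<gamma>01 T_def)
  define w where "w = E (- T) *v (y - x)"
  have "N w \<le> r"
  proof (cases "N w = 0")
    case True
    have "0 < ennreal r" using dist by (rule le_less_trans[OF zero_le])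
    then show ?thesis using True by simp
  next
    case False
    then have pos: "N w > 0" using N_nonneg[of w] by simp
    \<comment> \<open>Inner product with the normalized displacement: by Cauchy-Schwarz it grows no
      faster than the length, while between the ends of the path it increases by exactly
      \<open>N w\<close>.\<close>
    define l where "l v = B (E (- T) *v fst v) w / N w" for v :: "(real ^ 'n) \<times> real"
    have "linear l"
      by (rule linearI) (simp_all add: l_def matrix_vector_right_distrib matrix_vector_mult_scaleR
          bilinear_ladd[OF B_bilinear] bilinear_lmul[OF B_bilinear] add_divide_distrib)
    then have lin: "bounded_linear l" by (simp add: linear_conv_bounded_linear)
    have "l v \<le> sqrt (g (\<gamma> s) v v)" if "s \<in> {0..1}" for s v
    proof -
      have "B (E (- T) *v fst v) w \<le> N (E (- T) *v fst v) * N w"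
        unfolding N_def by (rule inner_product_form_Cauchy_Schwarz[OF B_inner_product_form])
      then have "l v \<le> N (E (- T) *v fst v)"
        using pos by (simp add: l_def divide_le_eq)
      also have "\<dots> \<le> N (E (- snd (\<gamma> s)) *v fst v)"
        by (rule N_mono[OF bound_T[OF that]])
      also have "\<dots> \<le> sqrt (g (\<gamma> s) v v)" by (rule width)
      finally show ?thesis .
    qed
    with bound[rule_format, of l 0 1] lin have "l (\<gamma> 1) - l (\<gamma> 0) \<le> integral {0..1} \<sigma>" by simp
    also have "integral {0..1} \<sigma> = I" using I(2) by (rule integral_unique)
    also have "l (\<gamma> 1) - l (\<gamma> 0) = B w w / N w"
      by (simp add: l_def \<gamma>01 w_def bilinear_lsub[OF B_bilinear] matrix_vector_mult_diff_distrib diff_divide_distrib)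
    also have "\<dots> = N w"
      using B_nonneg by (simp add: N_def real_div_sqrt)
    finally show ?thesis using I(1) by simp
  qed
  then show "N (E (- ((r + t + u) / 2)) *v (y - x)) \<le> r"
    by (simp add: w_def T_def)
qed

section \<open>Volume growth of balls\<close>

lemma riem_volume_density:
  obtains c where "c > 0"
    "riem_volume g = density lborel (\<lambda>p. ennreal (c * exp (- (snd p * trace A))))"
proof -
  obtain c where c: "c > 0"
    "\<And>x t. sqrt (Determinants.det (\<chi> i j. g (x, t) (coord_frame i) (coord_frame j) :: real ^ ('n option) ^ ('n option)))
       = c * exp (- (t * trace A))"
    using volume_density by blast
  have "riem_volume g = density lborel (\<lambda>p. ennreal (c * exp (- (snd p * trace A))))"
    unfolding riem_volume_def by (rule arg_cong[of _ _ "density lborel"]) (auto simp: c(2))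
  with c(1) show thesis by (rule that)
qed

text \<open>The set is a translate of the image of a Euclidean ball under \<open>E T\<close>, whose
  determinant gives the exponential factor.\<close>

lemma emeasure_E_cball:
  assumes "\<rho> \<ge> 0"
  shows "emeasure lborel {y. norm (E (- T) *v (y - x)) \<le> \<rho>} =
    ennreal (exp (T * trace A) * (unit_ball_vol (real CARD('n)) * \<rho> ^ CARD('n)))"
proof -
  let ?V = "{y. norm (E (- T) *v (y - x)) \<le> \<rho>}"
  have V: "?V = (+) x ` ((*v) (E T)) ` cball 0 \<rho>"
  proof safe
    fix y assume "norm (E (- T) *v (y - x)) \<le> \<rho>"
    then have "E (- T) *v (y - x) \<in> cball 0 \<rho>" by simp
    moreover have "y = x + E T *v (E (- T) *v (y - x))" by simp
    ultimately show "y \<in> (+) x ` ((*v) (E T)) ` cball 0 \<rho>" by blast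
  qed simp
  have lin: "linear ((*v) (E T))" by simp
  have lm: "((*v) (E T)) ` cball 0 \<rho> \<in> lmeasurable"
    and image: "measure lebesgue ((*v) (E T) ` cball 0 \<rho>) =
      \<bar>Determinants.det (E T)\<bar> * measure lebesgue (cball (0 :: real ^ 'n) \<rho>)"
    using lmeasurable_linear_image_cart[OF lin] lmeasurable_cball by auto
  have "measure lebesgue ?V = measure lebesgue ((*v) (E T) ` cball 0 \<rho>)"
    unfolding V by (rule measure_translation)
  also have "\<dots> = exp (T * trace A) * measure lebesgue (cball (0 :: real ^ 'n) \<rho>)"
    by (simp add: image det_E)
  also have "measure lebesgue (cball (0 :: real ^ 'n) \<rho>) = unit_ball_vol (real CARD('n)) * \<rho> ^ CARD('n)"
    using content_cball[OF assms, of "0 :: real ^ 'n"] by simp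
  finally have m: "measure lebesgue ?V = exp (T * trace A) * (unit_ball_vol (real CARD('n)) * \<rho> ^ CARD('n))" .
  have "?V \<in> lmeasurable"
    unfolding V by (rule measurable_translation[OF lm])
  \<comment> \<open>On Borel sets \<open>lebesgue\<close> and \<open>lborel\<close> agree, which
    transfers the value.\<close>
  moreover have "?V \<in> sets borel"
    by (intro borel_closed closed_Collect_le continuous_intros)
  ultimately show ?thesis
    using emeasure_eq_measure2[of ?V lebesgue] by (simp add: m)
qed

lemma volume_upper_bound:
  obtains C where "C > 0"
    "\<And>r. r > 0 \<Longrightarrow> emeasure (riem_volume g) (riem_ball g p r) \<le>
      ennreal (C * r ^ (CARD('n) + 1) * exp (r * trace A))"
proof -
  obtain c where c: "c > 0" "riem_volume g = density lborel (\<lambda>p. ennreal (c * exp (- (snd p * trace A))))"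
    using riem_volume_density by blast
  obtain k where k: "k > 0" "\<And>v. k * norm v \<le> N v"
    using inner_product_form_norm_bound[OF B_inner_product_form] unfolding N_def by blast
  obtain x t where p: "p = (x, t)" by fastforce
  let ?n = "CARD('n)" and ?h = "trace A"
  let ?v = "unit_ball_vol (real ?n)"
  \<comment> \<open>The factor \<open>2\<close> comes from the range of heights, of length
    \<open>2 * r\<close>; \<open>?v / k ^ ?n\<close> comes from Euclidean balls of radius
    \<open>r / k\<close>.\<close>
  define C where "C = 2 * c * ?v / k ^ ?n"
  have "C > 0" using c k by (simp add: C_def)
  moreover have "emeasure (riem_volume g) (riem_ball g p r) \<le> ennreal (C * r ^ (?n + 1) * exp (r * ?h))"
    if r: "r > 0" for r
  proof -
    define T where "T u = (r + t + u) / 2" for u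
    define M where "M = c * ?v * (r / k) ^ ?n * exp (r * ?h)"
    \<comment> \<open>A closed set containing the ball, whose slice at each height within
      \<open>r\<close> of \<open>t\<close> is of the kind measured by
      \<open>emeasure_E_cball\<close>.\<close>
    define U where "U = {q. \<bar>snd q - t\<bar> \<le> r \<and> norm (E (- T (snd q)) *v (fst q - x)) \<le> r / k}"
    have "closed U"
      unfolding U_def T_def
      by (intro closed_Collect_conj closed_Collect_le continuous_intros) auto
    then have U_meas [measurable]: "U \<in> sets borel" by (rule borel_closed)
    have sub: "riem_ball g p r \<subseteq> U"
    proof
      fix q assume "q \<in> riem_ball g p r"
      then have d: "riem_dist g (x, t) (fst q, snd q) < ennreal r" by (simp add: riem_ball_def p)
      have "k * norm (E (- T (snd q)) *v (fst q - x)) \<le> r"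
        using order_trans[OF k(2) riem_dist_estimate(2)[OF d]] by (simp add: T_def)
      then show "q \<in> U"
        using riem_dist_estimate(1)[OF d] k(1) by (simp add: U_def field_simps)
    qed
    have inner: "(\<integral>\<^sup>+ y. ennreal (c * exp (- (u * ?h))) * indicator U (y, u) \<partial>lborel) \<le>
        ennreal M * indicator {t - r..t + r} u" for u
    proof (cases "u \<in> {t - r..t + r}")
      case True
      then have "(indicator U (y, u) :: ennreal) = indicator {y. norm (E (- T u) *v (y - x)) \<le> r / k} y" for y
        by (auto simp: U_def indicator_def)
      moreover have "{y. norm (E (- T u) *v (y - x)) \<le> r / k} \<in> sets borel"
        by (intro borel_closed closed_Collect_le continuous_intros)
      ultimately have "(\<integral>\<^sup>+ y. ennreal (c * exp (- (u * ?h))) * indicator U (y, u) \<partial>lborel) =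
          ennreal (c * exp (- (u * ?h))) * ennreal (exp (T u * ?h) * (?v * (r / k) ^ ?n))"
        using r k by (simp add: nn_integral_cmult_indicator emeasure_E_cball)
      also have "\<dots> = ennreal (c * ?v * (r / k) ^ ?n * exp (T u * ?h - u * ?h))"
        using c r k by (subst ennreal_mult[symmetric]) (auto simp: exp_diff exp_minus field_simps)
      also have "\<dots> \<le> ennreal M"
      proof -
        \<comment> \<open>The weighted slice is largest at the lowest height
          \<open>u = t - r\<close>, where the exponent equals \<open>r * ?h\<close>.\<close>
        have "T u * ?h - u * ?h = (r + t - u) / 2 * ?h"
          by (simp add: T_def field_simps)
        also have "\<dots> \<le> r * ?h"
          using True by (intro mult_right_mono trace_nonneg) auto
        finally show ?thesis
          unfolding M_def using c r k by (intro ennreal_leI mult_left_mono) auto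
      qed
      finally show ?thesis using True by simp
    next
      case False
      then have "(y, u) \<notin> U" for y by (auto simp: U_def)
      then show ?thesis by simp
    qed
    have f_meas: "(\<lambda>p :: (real ^ 'n) \<times> real. ennreal (c * exp (- (snd p * ?h)))) \<in> borel_measurable borel"
      by (intro measurable_compose[OF _ measurable_ennreal] borel_measurable_continuous_onI continuous_intros)
    have "emeasure (riem_volume g) (riem_ball g p r) \<le> emeasure (riem_volume g) U"
      by (rule emeasure_mono[OF sub]) (simp add: c(2))
    also have "\<dots> = (\<integral>\<^sup>+ q. ennreal (c * exp (- (snd q * ?h))) * indicator U q \<partial>lborel)"
      unfolding c(2) using f_meas by (intro emeasure_density) auto
    also have "\<dots> = (\<integral>\<^sup>+ q. ennreal (c * exp (- (snd q * ?h))) * indicator U q \<partial>(lborel \<Otimes>\<^sub>M lborel))"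
      by (simp add: lborel_prod)
    also have "\<dots> = (\<integral>\<^sup>+ u. \<integral>\<^sup>+ y. ennreal (c * exp (- (u * ?h))) * indicator U (y, u) \<partial>lborel \<partial>lborel)"
      using f_meas by (subst lborel_pair.nn_integral_snd[symmetric]) (auto simp: lborel_prod)
    also have "\<dots> \<le> (\<integral>\<^sup>+ u. ennreal M * indicator {t - r..t + r} u \<partial>lborel)"
      by (intro nn_integral_mono inner)
    also have "\<dots> = ennreal M * ennreal (2 * r)"
      using r by (simp add: nn_integral_cmult_indicator)
    also have "\<dots> = ennreal (C * r ^ (?n + 1) * exp (r * ?h))"
      using c k r by (subst ennreal_mult[symmetric]) (auto simp: M_def C_def power_divide field_simps)
    finally show ?thesis .
  qed
  ultimately show thesis by (rule that)
qed

lemma volume_lower_bound: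
  obtains c where "c > 0"
    "\<And>r. r \<ge> 2 \<Longrightarrow> ennreal (c * exp (r * trace A)) \<le> emeasure (riem_volume g) (riem_ball g p r)"
proof -
  obtain c where c: "c > 0" "riem_volume g = density lborel (\<lambda>p. ennreal (c * exp (- (snd p * trace A))))"
    using riem_volume_density by blast
  obtain x t where p: "p = (x, t)" by fastforce
  let ?h = "trace A"
  have "open {y. N (E (- t) *v (y - x)) < 1}"
    unfolding N_def by (intro open_Collect_less continuous_intros)
  moreover have "x \<in> {y. N (E (- t) *v (y - x)) < 1}"
    by (simp add: N_def bilinear_lzero[OF B_bilinear])
  \<comment> \<open>The base of the box is chosen before \<open>r\<close>, so its measure
    \<open>m\<close> is a constant.\<close>
  ultimately obtain \<rho> where \<rho>: "\<rho> > 0" "ball x \<rho> \<subseteq> {y. N (E (- t) *v (y - x)) < 1}"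
    using open_contains_ball by blast
  define m where "m = measure lborel (ball x \<rho>)"
  have m: "emeasure lborel (ball x \<rho>) = ennreal m"
    unfolding m_def using emeasure_bounded_finite[OF bounded_ball, of x \<rho>]
    by (intro emeasure_eq_ennreal_measure) auto
  have "m > 0" unfolding m_def using \<rho>(1) by (rule content_ball_pos)
  \<comment> \<open>The density is bounded below by its value at the top \<open>t - r + 2\<close> of
    the box, where the part of the exponent containing \<open>r\<close> splits off; the box has
    height \<open>1\<close> and hence measure \<open>m\<close>.\<close>
  define c' where "c' = c * exp (- ((t + 2) * ?h)) * m"
  have "c' > 0" using c \<open>m > 0\<close> by (simp add: c'_def)
  moreover have "ennreal (c' * exp (r * ?h)) \<le> emeasure (riem_volume g) (riem_ball g p r)" if r: "r \<ge> 2" for r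
  proof -
    define J where "J = {t - r + 1<..<t - r + 2}"
    let ?W = "ball x \<rho> \<times> J"
    have sub: "?W \<subseteq> riem_ball g p r"
    proof safe
      fix y u assume y: "y \<in> ball x \<rho>" and u: "u \<in> J"
      \<comment> \<open>Less than \<open>1\<close> is spent horizontally and less than
        \<open>r - 1\<close> vertically; for heights in \<open>J\<close> the latter uses
        \<open>r \<ge> 2\<close>.\<close>
      have "riem_dist g (x, t) (y, u) < ennreal (1 + (r - 1))"
        using y \<rho>(2) u r by (intro riem_dist_less) (auto simp: J_def)
      then show "(y, u) \<in> riem_ball g p r" by (simp add: riem_ball_def p)
    qed
    have f_meas: "(\<lambda>p :: (real ^ 'n) \<times> real. ennreal (c * exp (- (snd p * ?h)))) \<in> borel_measurable borel"
      by (intro measurable_compose[OF _ measurable_ennreal] borel_measurable_continuous_onI continuous_intros)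
    have W_meas: "?W \<in> sets borel"
      by (intro borel_open open_Times) (auto simp: J_def)
    have W: "emeasure lborel ?W = ennreal m"
      unfolding lborel_prod[symmetric]
      by (subst lborel.emeasure_pair_measure_Times) (auto simp: m J_def)
    have "ennreal (c' * exp (r * ?h)) = ennreal (c * exp (- ((t - r + 2) * ?h))) * ennreal m"
      using c \<open>m > 0\<close> by (subst ennreal_mult[symmetric])
        (auto simp: c'_def algebra_simps simp flip: exp_add)
    also have "\<dots> = (\<integral>\<^sup>+ q. ennreal (c * exp (- ((t - r + 2) * ?h))) * indicator ?W q \<partial>lborel)"
      using W W_meas by (simp add: nn_integral_cmult_indicator)
    also have "\<dots> \<le> (\<integral>\<^sup>+ q. ennreal (c * exp (- (snd q * ?h))) * indicator ?W q \<partial>lborel)"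
    proof (rule nn_integral_mono)
      fix q :: "(real ^ 'n) \<times> real"
      show "ennreal (c * exp (- ((t - r + 2) * ?h))) * indicator ?W q \<le>
          ennreal (c * exp (- (snd q * ?h))) * indicator ?W q"
      proof (cases "q \<in> ?W")
        case True
        then have "snd q * ?h \<le> (t - r + 2) * ?h"
          by (intro mult_right_mono trace_nonneg) (auto simp: J_def)
        then show ?thesis using True c(1) by (auto intro!: ennreal_leI)
      qed simp
    qed
    also have "\<dots> = emeasure (riem_volume g) ?W"
      unfolding c(2) using f_meas W_meas by (intro emeasure_density[symmetric]) auto
    also have "\<dots> \<le> emeasure (riem_volume g) (riem_ball g p r)"
      by (rule emeasure_mono[OF sub]) (simp add: c(2) open_riem_ball)
    finally show ?thesis .
  qed
  ultimately show thesis by (rule that)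
qed

text \<open>After taking logarithms and dividing by \<open>r\<close>, the constants contribute terms
  of order \<open>1 / r\<close> and the polynomial factor a multiple of \<open>ln r / r\<close>; all
  of these tend to \<open>0\<close>, so both bounds converge to \<open>trace A\<close>.\<close>

theorem volume_entropy: "has_volume_entropy g (trace A)"
  unfolding has_volume_entropy_def
proof
  fix p :: "(real ^ 'n) \<times> real"
  let ?h = "trace A" and ?n = "CARD('n) + 1"
  let ?V = "\<lambda>r. measure (riem_volume g) (riem_ball g p r)"
  obtain C where C: "C > 0" "\<And>r. r > 0 \<Longrightarrow> emeasure (riem_volume g) (riem_ball g p r) \<le>
      ennreal (C * r ^ ?n * exp (r * ?h))"
    using volume_upper_bound by blast
  obtain c where c: "c > 0"
    "\<And>r. r \<ge> 2 \<Longrightarrow> ennreal (c * exp (r * ?h)) \<le> emeasure (riem_volume g) (riem_ball g p r)"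
    using volume_lower_bound by blast
  have V: "c * exp (r * ?h) \<le> ?V r" "?V r \<le> C * r ^ ?n * exp (r * ?h)" if "r \<ge> 2" for r
  proof -
    \<comment> \<open>The upper bound makes the volume finite; at infinite volume
      \<open>measure\<close> would take the default value \<open>0\<close>.\<close>
    have "emeasure (riem_volume g) (riem_ball g p r) = ennreal (?V r)"
      using C(2)[of r] that by (intro emeasure_eq_ennreal_measure) (auto simp: top_unique)
    then show "c * exp (r * ?h) \<le> ?V r" "?V r \<le> C * r ^ ?n * exp (r * ?h)"
      using C(1) C(2)[of r] c(2)[of r] that by (auto simp: ennreal_le_iff)
  qed
  show "((\<lambda>r. ln (?V r) / r) \<longlongrightarrow> ?h) at_top"
  proof (rule tendsto_sandwich)
    show "\<forall>\<^sub>F r in at_top. ln c / r + ?h \<le> ln (?V r) / r"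
    proof (rule eventually_mono[OF eventually_ge_at_top[of 2]])
      fix r :: real assume r: "r \<ge> 2"
      have "ln (c * exp (r * ?h)) \<le> ln (?V r)"
        using V(1)[OF r] c(1) by (intro ln_mono) auto
      then have "(ln c + r * ?h) / r \<le> ln (?V r) / r"
        using r c(1) by (intro divide_right_mono) (auto simp: ln_mult)
      then show "ln c / r + ?h \<le> ln (?V r) / r"
        using r by (simp add: add_divide_distrib)
    qed
    show "\<forall>\<^sub>F r in at_top. ln (?V r) / r \<le> ln C / r + real ?n * (ln r / r) + ?h"
    proof (rule eventually_mono[OF eventually_ge_at_top[of 2]])
      fix r :: real assume r: "r \<ge> 2"
      have "0 < ?V r" using V(1)[OF r] c(1) by (smt (verit) exp_gt_zero mult_pos_pos)
      then have "ln (?V r) \<le> ln (C * r ^ ?n * exp (r * ?h))"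
        using V(2)[OF r] by (intro ln_mono) auto
      also have "\<dots> = ln C + real ?n * ln r + r * ?h"
        using r C(1) by (simp add: ln_mult ln_realpow del: power_Suc power_add)
      finally have "ln (?V r) / r \<le> (ln C + real ?n * ln r + r * ?h) / r"
        using r by (intro divide_right_mono) auto
      then show "ln (?V r) / r \<le> ln C / r + real ?n * (ln r / r) + ?h"
        using r by (simp add: add_divide_distrib)
    qed
    show "((\<lambda>r. ln c / r + ?h) \<longlongrightarrow> ?h) at_top"
      by real_asymp
    show "((\<lambda>r. ln C / r + real ?n * (ln r / r) + ?h) \<longlongrightarrow> ?h) at_top"
      by real_asymp
  qed
qed

end

text \<open>Similarity preserves the trace, so the complex Jordan form has trace
  \<open>trace A\<close>. The eigenvalue hypothesis yields both \<open>trace_nonneg\<close> and,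
  through the real Jordan basis, \<open>monotone\<close>; the conclusion is then
  \<open>volume_entropy\<close>.\<close>

theorem corollary3:
  fixes A :: "real ^ 'n ^ 'n"
    and g :: "((real ^ 'n) \<times> real) metric_form"
    and n_as :: "(nat \<times> complex) list"
  assumes "diagonalizable_mat (complex_mat_of A)"
    and "\<And>\<mu>. eigenvalue (complex_mat_of A) \<mu> \<Longrightarrow> Re \<mu> > 0"
    and "heintze_metric A g"
    and "jordan_nf (complex_mat_of A) n_as"
  shows "\<exists>\<delta>. has_volume_entropy g \<delta> \<and> complex_of_real \<delta> = mat_trace (jordan_matrix n_as)"
proof -
  have "similar_mat (complex_mat_of A) (jordan_matrix n_as)"
    using assms(4) by (simp add: jordan_nf_def)
  then have tr: "complex_of_real (trace A) = mat_trace (jordan_matrix n_as)"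
    using mat_trace_similar mat_trace_complex_mat_of by metis
  have car: "complex_mat_of A \<in> carrier_mat CARD('n) CARD('n)"
    by (simp add: complex_mat_of_def)
  \<comment> \<open>The induction runs over lists \<open>ns\<close> of blocks drawn from
    \<open>n_as\<close>, so that every entry remains an eigenvalue of the fixed matrix.\<close>
  have "Re (\<Sum>(n, a)\<leftarrow>ns. of_nat n * a) \<ge> 0" if "set ns \<subseteq> set n_as" for ns
    using that
  proof (induction ns)
    case (Cons na ns)
    obtain n a where na: "na = (n, a)" by fastforce
    have "Re a > 0"
      using assms(2) jordan_nf_eigenvalue[OF car assms(4), of n a] Cons.prems by (simp add: na)
    then show ?case using Cons by (simp add: na)
  qed simp
  from this[of n_as] have nonneg: "trace A \<ge> 0"
    unfolding mat_trace_jordan_matrix[symmetric] tr[symmetric] by simp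
  have inv: "left_invariant A g" and inner: "inner_product_form (g 0)"
    and unit: "g 0 (0, 1) (0, 1) = 1" and orth: "\<And>v. g 0 (v, 0) (0, 1) = 0"
    using assms(3) by (simp_all add: heintze_metric_def)
  obtain b where b: "real_jordan_basis A b"
    "\<And>i j. i < CARD('n) \<Longrightarrow> j < CARD('n) \<Longrightarrow> g 0 (b i, 0) (b j, 0) = (if i = j then 1 else 0)"
    using assms(3) unfolding heintze_metric_def by blast
  have "bilinear (\<lambda>v w. g 0 (v, 0) (w, 0))"
  proof -
    have emb: "linear (\<lambda>v :: real ^ 'n. (v, 0 :: real))"
      by (rule linearI) simp_all
    have "linear (g 0 p)" "linear (\<lambda>q. g 0 q p)" for p
      using inner unfolding inner_product_form_def bilinear_def by blast+
    from this[THEN linear_compose[OF emb]] show ?thesis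
      by (simp add: bilinear_def o_def)
  qed
  then have "g 0 (A *v v, 0) (v, 0) \<ge> 0" for v
    using real_jordan_basis_monotone[OF assms(2) b(1)] b(2) by blast
  with inv inner unit orth nonneg interpret heintze_group A g
    by unfold_locales
  from volume_entropy tr show ?thesis by blast
qed

end
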